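(* Let $\Gamma=\langle S\mid R\rangle$ be a finitely presented group with two ends. Any Cayley graph $G$ of $\Gamma$ with degree $3$ or more satisfies $\mu(G)\ge\phi$, where $\phi=\frac12(1+\sqrt5)$.
   Context: Cayley graphs are with respect to finite, symmetric generator sets not containing the identity, and are taken in simple form (multiple edges coalesce). The number of ends of a connected graph is the supremum over its finite subgraphs $H$ of the number of infinite components remaining after removal of $H$; the number of ends of a finitely generated group is that of any of its Cayley graphs. A self-avoiding walk (SAW) is a walk with no repeated vertex; $\sigma_n$ is the number of $n$-step SAWs from a given vertex, and the connective constant is $\mu(G)=\lim_{n\to\infty}\sigma_n^{1/n}$ (the limit exists). *)

theory Defs
  imports
    Complex_Main
    "HOL-Library.Extended_Nat"
    "HOL-Algebra.Generated_Groups"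
    "Graph_Theory.Digraph_Component"
    "Graph_Theory.Vertex_Walk"
begin

section \<open>Group presentations\<close>

text \<open>
  The letter \<open>(x, True)\<close> stands for the generator \<open>x\<close> and \<open>(x, False)\<close> for its formal inverse.
\<close>

type_synonym 'x gword = "('x \<times> bool) list"

definition gwords :: "'x set \<Rightarrow> 'x gword set" where
  "gwords X = lists (X \<times> UNIV)"

text \<open>
  The congruence on words that is generated by \<open>x x\<^sup>-\<^sup>1 = x\<^sup>-\<^sup>1 x = 1\<close> and by \<open>r = 1\<close> for \<open>r \<in> R\<close>.
\<close>

inductive pres_eq :: "'x set \<Rightarrow> 'x gword set \<Rightarrow> 'x gword \<Rightarrow> 'x gword \<Rightarrow> bool"
  for X :: "'x set" and R :: "'x gword set" where
  refl: "w \<in> gwords X \<Longrightarrow> pres_eq X R w w"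
| sym: "pres_eq X R v w \<Longrightarrow> pres_eq X R w v"
| trans: "pres_eq X R u v \<Longrightarrow> pres_eq X R v w \<Longrightarrow> pres_eq X R u w"
| cancel: "\<lbrakk>u \<in> gwords X; v \<in> gwords X; x \<in> X\<rbrakk>
    \<Longrightarrow> pres_eq X R (u @ [(x, b), (x, \<not> b)] @ v) (u @ v)"
| relator: "\<lbrakk>u \<in> gwords X; v \<in> gwords X; r \<in> gwords X; r \<in> R\<rbrakk>
    \<Longrightarrow> pres_eq X R (u @ r @ v) (u @ v)"

definition pres_rel :: "'x set \<Rightarrow> 'x gword set \<Rightarrow> ('x gword \<times> 'x gword) set" where
  "pres_rel X R = {(v, w). pres_eq X R v w}"

definition presented_group :: "'x set \<Rightarrow> 'x gword set \<Rightarrow> 'x gword set monoid" where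
  "presented_group X R =
    \<lparr> carrier = gwords X // pres_rel X R,
      monoid.mult = (\<lambda>A B. \<Union>v\<in>A. \<Union>w\<in>B. pres_rel X R `` {v @ w}),
      one = pres_rel X R `` {[]} \<rparr>"

lemma gwords_simps [simp]:
  "[] \<in> gwords X"
  "a # w \<in> gwords X \<longleftrightarrow> fst a \<in> X \<and> w \<in> gwords X"
  "v @ w \<in> gwords X \<longleftrightarrow> v \<in> gwords X \<and> w \<in> gwords X"
  by (cases a; auto simp: gwords_def)+

lemma pres_eq_gwords: "pres_eq X R v w \<Longrightarrow> v \<in> gwords X \<and> w \<in> gwords X"
  by (induction rule: pres_eq.induct) auto

lemma equiv_pres_rel: "equiv (gwords X) (pres_rel X R)"
  unfolding pres_rel_def
  by (intro equivI refl_onI symI transI)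
     (auto dest: pres_eq_gwords intro: pres_eq.intros)

lemma pres_eq_context:
  "pres_eq X R v w \<Longrightarrow> a \<in> gwords X \<Longrightarrow> b \<in> gwords X \<Longrightarrow> pres_eq X R (a @ v @ b) (a @ w @ b)"
proof (induction rule: pres_eq.induct)
  case (cancel u v x c)
  then show ?case using pres_eq.cancel[of "a @ u" X "v @ b" x R c] by simp
next
  case (relator u v r)
  then show ?case using pres_eq.relator[of "a @ u" X "v @ b" r R] by simp
qed (auto intro: pres_eq.intros)

lemma pres_eq_append:
  assumes "pres_eq X R v v'" "pres_eq X R w w'"
  shows "pres_eq X R (v @ w) (v' @ w')"
  using pres_eq_context[OF assms(1), of "[]" w] pres_eq_context[OF assms(2), of v' "[]"]
    pres_eq_gwords[OF assms(1)] pres_eq_gwords[OF assms(2)]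
  by (auto intro: pres_eq.trans)

lemma presented_group_mult:
  assumes "v \<in> gwords X" "w \<in> gwords X"
  shows "pres_rel X R `` {v} \<otimes>\<^bsub>presented_group X R\<^esub> pres_rel X R `` {w} = pres_rel X R `` {v @ w}"
proof -
  have "congruent2 (pres_rel X R) (pres_rel X R) (\<lambda>v w. pres_rel X R `` {v @ w})"
    by (intro congruent2I' equiv_class_eq[OF equiv_pres_rel])
       (auto simp: pres_rel_def intro: pres_eq_append)
  then show ?thesis
    unfolding presented_group_def
    using UN_equiv_class2[OF equiv_pres_rel equiv_pres_rel _ assms] by simp
qed

lemma pres_eq_inverse:
  "w \<in> gwords X \<Longrightarrow> pres_eq X R (rev (map (apsnd Not) w) @ w) []"
proof (induction w)
  case Nil
  then show ?case by (simp add: pres_eq.refl)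
next
  case (Cons a w)
  obtain x b where a: "a = (x, b)" by force
  have inv: "rev (map (apsnd Not) w) \<in> gwords X"
    using Cons.prems by (force simp: gwords_def in_lists_conv_set)
  have "pres_eq X R (rev (map (apsnd Not) w) @ [(x, \<not> b), (x, \<not> \<not> b)] @ w)
      (rev (map (apsnd Not) w) @ w)"
    using Cons.prems a inv by (intro pres_eq.cancel) auto
  moreover have "pres_eq X R (rev (map (apsnd Not) w) @ w) []"
    using Cons by simp
  ultimately show ?case using a by (auto intro: pres_eq.trans)
qed

lemma group_presented_group: "group (presented_group X R)"
proof (rule groupI)
  let ?G = "presented_group X R" and ?r = "pres_rel X R"
  have carr: "carrier ?G = gwords X // ?r" and one: "\<one>\<^bsub>?G\<^esub> = ?r `` {[]}"
    by (simp_all add: presented_group_def)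
  show "\<one>\<^bsub>?G\<^esub> \<in> carrier ?G" by (simp add: carr one quotientI)
  fix A assume "A \<in> carrier ?G"
  then obtain u where u: "u \<in> gwords X" "A = ?r `` {u}"
    by (auto simp: carr elim: quotientE)
  show "\<one>\<^bsub>?G\<^esub> \<otimes>\<^bsub>?G\<^esub> A = A"
    using presented_group_mult[of "[]" X u R] u by (simp add: one)
  let ?v = "rev (map (apsnd Not) u)"
  have v: "?v \<in> gwords X" using u by (force simp: gwords_def in_lists_conv_set)
  have "(?v @ u, []) \<in> ?r" using pres_eq_inverse[OF u(1)] by (simp add: pres_rel_def)
  then have "?r `` {?v} \<otimes>\<^bsub>?G\<^esub> A = \<one>\<^bsub>?G\<^esub>"
    using presented_group_mult[OF v u(1)] u one equiv_class_eq[OF equiv_pres_rel] by metis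
  then show "\<exists>B\<in>carrier ?G. B \<otimes>\<^bsub>?G\<^esub> A = \<one>\<^bsub>?G\<^esub>"
    using v by (auto simp: carr intro: quotientI)
  fix B assume "B \<in> carrier ?G"
  then obtain v where v: "v \<in> gwords X" "B = ?r `` {v}"
    by (auto simp: carr elim: quotientE)
  show "A \<otimes>\<^bsub>?G\<^esub> B \<in> carrier ?G"
    using u v by (simp add: presented_group_mult carr quotientI)
  fix C assume "C \<in> carrier ?G"
  then obtain w where w: "w \<in> gwords X" "C = ?r `` {w}"
    by (auto simp: carr elim: quotientE)
  show "A \<otimes>\<^bsub>?G\<^esub> B \<otimes>\<^bsub>?G\<^esub> C = A \<otimes>\<^bsub>?G\<^esub> (B \<otimes>\<^bsub>?G\<^esub> C)"
    using u v w by (simp add: presented_group_mult)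
qed


section \<open>Cayley graphs\<close>

definition cayley_generators :: "('g, 'm) monoid_scheme \<Rightarrow> 'g set \<Rightarrow> bool" where
  "cayley_generators \<Gamma> T \<longleftrightarrow>
    finite T \<and> T \<subseteq> carrier \<Gamma> \<and> \<one>\<^bsub>\<Gamma>\<^esub> \<notin> T \<and> (\<forall>t\<in>T. inv\<^bsub>\<Gamma>\<^esub> t \<in> T) \<and>
    generate \<Gamma> T = carrier \<Gamma>"

text \<open>
  An undirected edge between \<open>g\<close> and \<open>h\<close> is the pair of arcs \<open>(g, h)\<close> and \<open>(h, g)\<close>. As arcs are
  ordered pairs of vertices, multiple edges coalesce.
\<close>

definition cayley_graph :: "('g, 'm) monoid_scheme \<Rightarrow> 'g set \<Rightarrow> ('g, 'g \<times> 'g) pre_digraph" where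
  "cayley_graph \<Gamma> T =
    \<lparr> verts = carrier \<Gamma>,
      arcs = {(g, g \<otimes>\<^bsub>\<Gamma>\<^esub> t) | g t. g \<in> carrier \<Gamma> \<and> t \<in> T},
      tail = fst, head = snd \<rparr>"

lemma (in group) cayley_graph_simple:
  assumes "cayley_generators G T"
  shows "sym_digraph (cayley_graph G T)"
    and "loopfree_digraph (cayley_graph G T)"
    and "nomulti_digraph (cayley_graph G T)"
proof -
  have T: "t \<in> carrier G" "inv t \<in> T" "t \<noteq> \<one>" if "t \<in> T" for t
    using assms that by (auto simp: cayley_generators_def)
  have wf: "wf_digraph (cayley_graph G T)"
    by unfold_locales (auto simp: cayley_graph_def T)
  have "(g \<otimes> t, g) \<in> arcs (cayley_graph G T)" if "g \<in> carrier G" "t \<in> T" for g t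
    using that T[of t] T(2)[of t]
    by (auto simp: cayley_graph_def m_assoc intro!: exI[of _ "g \<otimes> t"] exI[of _ "inv t"])
  then have "symmetric (cayley_graph G T)"
    unfolding symmetric_def arcs_ends_conv by (intro symI) (force simp: cayley_graph_def)
  with wf show "sym_digraph (cayley_graph G T)"
    by (simp add: wf_digraph.sym_digraphI)
  show "loopfree_digraph (cayley_graph G T)"
    using wf T
    by (auto simp: loopfree_digraph_def loopfree_digraph_axioms_def cayley_graph_def)
  show "nomulti_digraph (cayley_graph G T)"
    using wf
    by (auto simp: nomulti_digraph_def nomulti_digraph_axioms_def cayley_graph_def arc_to_ends_def)
qed

lemma (in group) out_degree_cayley_graph:
  assumes "cayley_generators G T" "v \<in> carrier G"
  shows "out_degree (cayley_graph G T) v = card T"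
proof -
  have T: "T \<subseteq> carrier G" using assms by (simp add: cayley_generators_def)
  have "out_arcs (cayley_graph G T) v = (\<lambda>t. (v, v \<otimes> t)) ` T"
    using assms(2) by (auto simp: out_arcs_def cayley_graph_def)
  moreover have "inj_on (\<lambda>t. (v, v \<otimes> t)) T"
    using T assms(2) by (intro inj_onI) (simp add: subset_iff Units_eq)
  ultimately show ?thesis by (simp add: out_degree_def card_image)
qed


section \<open>Ends\<close>

text \<open>
  In a symmetric digraph the strongly connected components are the connected components of the
  underlying undirected graph.
\<close>

definition infinite_components :: "('a, 'b) pre_digraph \<Rightarrow> ('a, 'b) pre_digraph set" where
  "infinite_components G = {C \<in> pre_digraph.sccs G. infinite (verts C)}"

definition num_infinite_components :: "('a, 'b) pre_digraph \<Rightarrow> enat" where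
  "num_infinite_components G =
    (if finite (infinite_components G) then enat (card (infinite_components G)) else \<infinity>)"

text \<open>Removing \<open>H\<close> deletes its vertices and every edge with an endpoint in \<open>H\<close>.\<close>

definition num_ends :: "('a, 'b) pre_digraph \<Rightarrow> enat" where
  "num_ends G =
    (SUP H \<in> {H. subgraph H G \<and> fin_digraph H}.
      num_infinite_components (G \<restriction> (verts G - verts H)))"

text \<open>
  For a finitely generated group, the number of ends of a Cayley graph does not depend on the
  generators, so any admissible set may be chosen. Otherwise there is no such set and the value
  is meaningless.
\<close>

definition group_ends :: "('g, 'm) monoid_scheme \<Rightarrow> enat" where
  "group_ends \<Gamma> = num_ends (cayley_graph \<Gamma> (SOME T. cayley_generators \<Gamma> T))"


section \<open>Self-avoiding walks\<close>

definition saw_count :: "('a, 'b) pre_digraph \<Rightarrow> 'a \<Rightarrow> nat \<Rightarrow> nat" where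
  "saw_count G v n = card {p. vpath p G \<and> hd p = v \<and> vwalk_length p = n}"

definition connective_constant :: "('a, 'b) pre_digraph \<Rightarrow> 'a \<Rightarrow> real" where
  "connective_constant G v = lim (\<lambda>n. root n (real (saw_count G v n)))"

end

theory Submission
  imports Defs "HOL-Library.Sublist"
begin

text \<open>
  A set \<open>E\<close> of vertices with finite boundary such that \<open>E\<close> and its complement are infinite is moved
  by every element of a two-ended group to itself or to its complement, up to finitely many
  vertices. Counting, with sign, the vertices by which a (possibly complemented) translate of \<open>E\<close>
  exceeds \<open>E\<close> yields an action \<open>x \<mapsto> \<epsilon> g * x + \<tau> g\<close> on the real line, \<open>\<epsilon> g = \<plusminus>1\<close>, and translates of \<open>E\<close>
  to far away show that it has no global fixed point. The orbit of a point \<open>x\<close> is a height function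
  on the Cayley graph, along which the neighbours of a vertex are displaced by the displacements of
  \<open>x\<close> under the generators, up to a common sign. For suitable \<open>x\<close>, either every vertex has a neighbour
  that is strictly higher and another one that is not lower, so that self-avoiding walks can be
  concatenated from blocks of lengths 1 and 2; or all generators are reflections in two centres,
  and there are two blocks of length 2 and two of length 4. As \<open>r = 1 / \<phi>\<close> satisfies \<open>r + r\<^sup>2 = 1\<close> and
  \<open>2 r\<^sup>2 + 2 r\<^sup>4 \<ge> 1\<close>, the number of walks grows at least like \<open>\<phi>\<^sup>n\<close> in both cases.
\<close>

section \<open>Growth of the number of self-avoiding walks\<close>

lemma vwalk_butlast_append:
  assumes "vwalk p G" "vwalk q G" "hd q = last p"
  shows "vwalk (butlast p @ q) G"
proof -
  have "joinable p q" using assms by (auto simp: joinable_def vwalk_def)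
  then show ?thesis
    using vwalk_joinI_vwalk[OF assms(1,2)] by (simp add: vwalk_join_def2)
qed

lemma vwalk_arcs_map: "vwalk_arcs (map f p) = map (map_prod f f) (vwalk_arcs p)"
  by (induction p rule: vwalk_arcs.induct) auto

text \<open>A block ends strictly above its earlier vertices and the continuation stays at or above
  that end, so gluing blocks yields self-avoiding walks; since no block is a proper prefix of
  another, different choices yield different walks. The weight condition is a reversed Kraft
  inequality and makes this recursion grow at least like \<open>c ^ n\<close>. The factor
  \<open>c ^ L\<close> pays for the lengths \<open>n < L\<close>, which may be shorter than some
  block.\<close>

lemma exponential_saw_bound:
  fixes G :: "('a, 'b) pre_digraph" and A :: "'a set" and h :: "'a \<Rightarrow> 'c::linorder"
    and Bl :: "'a \<Rightarrow> 'a list set" and L :: nat and c :: real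
  assumes fin: "\<And>v n. v \<in> A \<Longrightarrow> finite {p. vpath p G \<and> hd p = v \<and> vwalk_length p = n}"
    and c: "1 \<le> c"
    and block: "\<And>v p. v \<in> A \<Longrightarrow> p \<in> Bl v \<Longrightarrow> vpath p G \<and> hd p = v \<and> 2 \<le> length p \<and>
      length p \<le> Suc L \<and> last p \<in> A \<and> (\<forall>x\<in>set p. h v \<le> h x) \<and>
      (\<forall>x\<in>set (butlast p). h x < h (last p))"
    and free: "\<And>v p q. v \<in> A \<Longrightarrow> p \<in> Bl v \<Longrightarrow> q \<in> Bl v \<Longrightarrow> prefix p q \<Longrightarrow> p = q"
    and finB: "\<And>v. v \<in> A \<Longrightarrow> finite (Bl v)"
    and weight: "\<And>v. v \<in> A \<Longrightarrow> 1 \<le> (\<Sum>p\<in>Bl v. (1 / c) ^ (length p - 1))"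
    and v: "v \<in> A"
  shows "c ^ n / c ^ L \<le> real (saw_count G v n)"
proof -
  \<comment> \<open>Walks that never drop below their starting height: the recursion bounds this
    smaller count.\<close>
  define P where "P n v = {p. vpath p G \<and> hd p = v \<and> vwalk_length p = n \<and>
    (\<forall>x\<in>set p. h v \<le> h x)}" for n v
  have finP: "finite (P n v)" if "v \<in> A" for n v
    by (rule finite_subset[OF _ fin[OF that, of n]]) (auto simp: P_def)
  have extend: "butlast p @ q \<in> P n v"
    if v: "v \<in> A" and p: "p \<in> Bl v" and q: "q \<in> P (n - (length p - 1)) (last p)"
      and n: "length p - 1 \<le> n" for v p q n
  proof -
    note b = block[OF v p]
    have ne: "p \<noteq> []" "q \<noteq> []" using b q by (auto simp: P_def vpath_def vwalk_def)
    have "hd (butlast p @ q) = v"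
      using b by (cases p) auto
    moreover have "vwalk (butlast p @ q) G"
      using b q by (intro vwalk_butlast_append) (auto simp: P_def vpath_def)
    moreover have "distinct (butlast p @ q)"
      using b q by (fastforce simp: P_def vpath_def distinct_butlast)
    moreover have "h v \<le> h x" if "x \<in> set (butlast p @ q)" for x
    proof -
      have "h v \<le> h (last p)" using b ne by auto
      then show ?thesis using that b q by (force simp: P_def dest: in_set_butlastD)
    qed
    moreover have "length (butlast p @ q) - 1 = n"
      using q n ne b by (cases q) (auto simp: P_def)
    ultimately show ?thesis by (auto simp: P_def vpath_def)
  qed
  have inj: "inj_on (\<lambda>(p, q). butlast p @ q)
      (SIGMA p:Bl v. P (n - (length p - 1)) (last p))" if v: "v \<in> A" for v n
  proof (rule inj_onI, clarify)
    fix p q p' q'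
    assume p: "p \<in> Bl v" "p' \<in> Bl v"
      and q: "q \<in> P (n - (length p - 1)) (last p)" "q' \<in> P (n - (length p' - 1)) (last p')"
      and eq: "butlast p @ q = butlast p' @ q'"
    \<comment> \<open>As \<open>hd q = last p\<close>, the duplicated vertex may be dropped from
      \<open>q\<close> instead, which exhibits the whole block as a prefix of the glued
      walk.\<close>
    have "butlast p @ q = p @ tl q" "butlast p' @ q' = p' @ tl q'"
      using q block[OF v p(1)] block[OF v p(2)]
      by (cases q; cases q'; auto simp: P_def vpath_def vwalk_def append_butlast_last_id
          simp flip: append_assoc; metis append_butlast_last_id append_Cons append_Nil append_assoc
            list.size(3) not_numeral_le_zero)+
    then have "p @ tl q = p' @ tl q'" using eq by simp
    then have "prefix p p' \<or> prefix p' p"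
      by (metis prefixI prefix_same_cases)
    then have "p = p'" using free[OF v] p by metis
    then show "p = p' \<and> q = q'" using eq by simp
  qed
  have Bne: "Bl v \<noteq> {}" if "v \<in> A" for v
    using weight[OF that] by auto
  have bound: "c ^ n / c ^ L \<le> real (card (P n v))" if "v \<in> A" for v
    using that
  proof (induction n arbitrary: v rule: less_induct)
    case (less n)
    note v = less.prems
    show ?case
    proof (cases "n < L")
      case True
      \<comment> \<open>For \<open>n < L\<close> the bound is at most 1, so one walk suffices: a
        block, either extended or cut off after \<open>n\<close> steps.\<close>
      obtain p where p: "p \<in> Bl v" using Bne[OF v] by auto
      note b = block[OF v p]
      have "P n v \<noteq> {}"
      proof (cases "length p - 1 \<le> n")
        case True
        have "n - (length p - 1) < n" using b True by auto
        then have "c ^ (n - (length p - 1)) / c ^ L \<le> real (card (P (n - (length p - 1)) (last p)))"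
          using less.IH b by blast
        moreover have "0 < c ^ (n - (length p - 1)) / c ^ L" using c by simp
        ultimately have "0 < real (card (P (n - (length p - 1)) (last p)))" by linarith
        then have "P (n - (length p - 1)) (last p) \<noteq> {}" by auto
        then show ?thesis using extend[OF v p _ True] by auto
      next
        case False
        then have n: "Suc n \<le> length p" by simp
        have "vwalk (take (Suc n) p @ drop (Suc n) p) G"
          using b unfolding append_take_drop_id vpath_def by simp
        then have "vwalk (take (Suc n) p) G"
          by (rule vwalkI_append_l[rotated]) (use n in auto)
        moreover have "hd (take (Suc n) p) = v"
          using b by (cases p) auto
        ultimately have "take (Suc n) p \<in> P n v"
          using b n by (auto simp: P_def vpath_def dest: in_set_takeD)
        then show ?thesis by auto
      qed
      then have "1 \<le> card (P n v)" using finP[OF v] by (simp add: Suc_le_eq card_gt_0_iff)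
      moreover have "c ^ n / c ^ L \<le> 1"
        using c True by (simp add: power_increasing)
      ultimately show ?thesis by linarith
    next
      case False
      have len: "length p - 1 \<le> n" "0 < length p - 1" if "p \<in> Bl v" for p
        using block[OF v that] False by auto
      \<comment> \<open>The weight condition distributes the target over the blocks; each share is
        what the induction hypothesis gives for the rest of the walk.\<close>
      have "c ^ n / c ^ L \<le> (c ^ n / c ^ L) * (\<Sum>p\<in>Bl v. (1 / c) ^ (length p - 1))"
        using mult_left_mono[OF weight[OF v], of "c ^ n / c ^ L"] c by simp
      also have "\<dots> = (\<Sum>p\<in>Bl v. c ^ (n - (length p - 1)) / c ^ L)"
        using c len by (auto simp: sum_distrib_left power_diff power_divide intro!: sum.cong)
      also have "\<dots> \<le> (\<Sum>p\<in>Bl v. real (card (P (n - (length p - 1)) (last p))))"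
        using block[OF v] len by (intro sum_mono less.IH) (force intro: diff_less)+
      also have "\<dots> = real (card (SIGMA p:Bl v. P (n - (length p - 1)) (last p)))"
        using block[OF v] finP finB[OF v] by (subst card_SigmaI) auto
      also have "\<dots> = real (card ((\<lambda>(p, q). butlast p @ q) `
          (SIGMA p:Bl v. P (n - (length p - 1)) (last p))))"
        using card_image[OF inj[OF v]] by simp
      also have "\<dots> \<le> real (card (P n v))"
        using extend[OF v] len by (intro of_nat_mono card_mono finP[OF v]) auto
      finally show ?thesis .
    qed
  qed
  have "card (P n v) \<le> saw_count G v n"
    unfolding saw_count_def by (rule card_mono[OF fin[OF v]]) (auto simp: P_def)
  then show ?thesis using bound[OF v] by linarith
qed

section \<open>Existence of the limit of roots\<close>

text \<open>Fekete's lemma; the limit is the infimum of the quotients over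
  \<open>n \<ge> 1\<close>.\<close>

lemma subadditive_tendsto:
  fixes a :: "nat \<Rightarrow> real"
  assumes sub: "\<And>m n. a (m + n) \<le> a m + a n" and nonneg: "\<And>n. 0 \<le> a n"
  shows "convergent (\<lambda>n. a n / real n)"
proof -
  define l where "l = (INF n\<in>{1..}. a n / real n)"
  have bdd: "bdd_below ((\<lambda>n. a n / real n) ` {1..})"
    using nonneg by (intro bdd_belowI[of _ 0]) auto
  have mult: "a (k * m + r) \<le> real k * a m + a r" for k m r
  proof (induction k)
    case (Suc k)
    have "a (Suc k * m + r) \<le> a m + a (k * m + r)"
      using sub[of m "k * m + r"] by (simp add: add.assoc)
    then show ?case using Suc by (simp add: algebra_simps)
  qed simp
  have "(\<lambda>n. a n / real n) \<longlonglongrightarrow> l"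
  proof (rule LIMSEQ_I)
    fix e :: real assume e: "0 < e"
    have "\<exists>m\<in>{1..}. a m / real m < l + e / 2"
      using cInf_lessD[of "(\<lambda>n. a n / real n) ` {1..}" "l + e / 2"] e unfolding l_def by auto
    then obtain m where m: "1 \<le> m" "a m / real m < l + e / 2" by auto
    \<comment> \<open>\<open>M\<close> bounds the contribution of the remainder
      \<open>n mod m\<close>; after division by \<open>n > N\<close> it is below
      \<open>e / 2\<close>.\<close>
    define M where "M = Max (a ` {..<m})"
    have M: "a r \<le> M" if "r < m" for r
      unfolding M_def using that by (intro Max_ge) auto
    have M0: "0 \<le> M" using M[of 0] m nonneg[of 0] by simp
    obtain N where N: "2 * M / e < real N" using reals_Archimedean2 by blast
    show "\<exists>no. \<forall>n\<ge>no. norm (a n / real n - l) < e"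
    proof (intro exI allI impI)
      fix n assume n: "Suc N \<le> n"
      have "l \<le> a n / real n" unfolding l_def using n by (intro cINF_lower[OF bdd]) auto
      moreover have "a n / real n < l + e"
      proof -
        have "a n \<le> real (n div m) * a m + a (n mod m)"
          using mult[of "n div m" m "n mod m"] by simp
        also have "\<dots> \<le> real n * (a m / real m) + M"
        proof -
          have "real (n div m) * a m \<le> (real n / real m) * a m"
            using of_nat_div_le_of_nat[of n m, where ?'a = real] nonneg by (intro mult_right_mono) auto
          then show ?thesis using M[of "n mod m"] m by simp
        qed
        also have "\<dots> < real n * (l + e / 2) + real n * (e / 2)"
        proof -
          have "2 * M / e < real n" using N n by simp
          then have "M < real n * (e / 2)" using e by (simp add: field_simps)
          moreover have "real n * (a m / real m) \<le> real n * (l + e / 2)"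
            using m by (intro mult_left_mono) auto
          ultimately show ?thesis by linarith
        qed
        finally have "a n < real n * (l + e)" by (simp add: algebra_simps)
        then show ?thesis using n by (simp add: field_simps)
      qed
      ultimately show "norm (a n / real n - l) < e" by (simp add: abs_less_iff)
    qed
  qed
  then show ?thesis by (rule convergentI)
qed

text \<open>Fekete's lemma applied to \<open>ln (s n)\<close>, which is nonnegative because
  \<open>1 \<le> s n\<close>.\<close>

lemma submultiplicative_root_convergent:
  fixes s :: "nat \<Rightarrow> real"
  assumes sub: "\<And>m n. s (m + n) \<le> s m * s n" and ge1: "\<And>n. 1 \<le> s n"
  shows "convergent (\<lambda>n. root n (s n))"
proof -
  have pos: "0 < s n" for n using ge1[of n] by simp
  have "convergent (\<lambda>n. ln (s n) / real n)"
  proof (rule subadditive_tendsto)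
    show "ln (s (m + n)) \<le> ln (s m) + ln (s n)" for m n
      using sub[of m n] pos by (simp flip: ln_mult_pos)
    show "0 \<le> ln (s n)" for n using ge1 by simp
  qed
  then obtain l where "(\<lambda>n. ln (s n) / real n) \<longlonglongrightarrow> l" by (auto simp: convergent_def)
  then have "(\<lambda>n. exp (ln (s n) / real n)) \<longlonglongrightarrow> exp l" by (rule tendsto_exp)
  moreover have "eventually (\<lambda>n. exp (ln (s n) / real n) = root n (s n)) sequentially"
    using eventually_gt_at_top[of 0]
  proof eventually_elim
    case (elim n)
    then show ?case using pos[of n] root_powr_inverse[OF elim less_imp_le[OF pos]] by (simp add: powr_def)
  qed
  ultimately show ?thesis
    by (intro convergentI[of _ "exp l"]) (rule Lim_transform_eventually)
qed

text \<open>Submultiplicativity provides the convergence that makes \<open>lim\<close> the actual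
  limit. The constant \<open>K\<close> disappears because its \<open>n\<close>-th root tends to
  1.\<close>

lemma lim_root_ge:
  fixes s :: "nat \<Rightarrow> real"
  assumes sub: "\<And>m n. s (m + n) \<le> s m * s n" and ge1: "\<And>n. 1 \<le> s n"
    and K: "0 < K" and c: "0 \<le> c" and lower: "\<And>n. c ^ n * K \<le> s n"
  shows "c \<le> lim (\<lambda>n. root n (s n))"
proof -
  have "(\<lambda>n. root n (s n)) \<longlonglongrightarrow> lim (\<lambda>n. root n (s n))"
    using submultiplicative_root_convergent[OF sub ge1] by (simp add: convergent_LIMSEQ_iff)
  moreover have "(\<lambda>n. c * root n K) \<longlonglongrightarrow> c * 1"
    using K by (intro tendsto_intros LIMSEQ_root_const)
  moreover have "c * root n K \<le> root n (s n)" if "1 \<le> n" for n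
  proof -
    have "c * root n K = root n (c ^ n * K)"
      using that c by (simp add: real_root_mult real_root_power_cancel)
    then show ?thesis using that lower by simp
  qed
  ultimately show ?thesis
    by (intro LIMSEQ_le[of "\<lambda>n. c * root n K" c]) auto
qed

lemma golden_ratio_inverse: "1 / ((1 + sqrt 5) / 2) = (sqrt 5 - 1) / (2 :: real)"
proof -
  have "(1 + sqrt 5) * (sqrt 5 - 1) = (4 :: real)" by (simp add: algebra_simps)
  moreover have "0 < 1 + sqrt (5 :: real)" by (simp add: add_pos_pos)
  ultimately show ?thesis by (simp add: field_simps)
qed

section \<open>Cayley graphs\<close>

context group
begin

subsection \<open>Self-avoiding walks in Cayley graphs\<close>

lemma arcs_ends_cayley_graph:
  "(x, y) \<in> arcs_ends (cayley_graph G T) \<longleftrightarrow> x \<in> carrier G \<and> (\<exists>t\<in>T. y = x \<otimes> t)"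
  by (auto simp: arcs_ends_def arc_to_ends_def cayley_graph_def image_iff)

lemma verts_cayley_graph [simp]: "verts (cayley_graph G T) = carrier G"
  by (simp add: cayley_graph_def)

lemma finite_vwalks_cayley_graph:
  assumes "cayley_generators G T"
  shows "finite {p. vwalk p (cayley_graph G T) \<and> hd p = v \<and> vwalk_length p = n}"
proof (induction n arbitrary: v)
  case 0
  have "{p. vwalk p (cayley_graph G T) \<and> hd p = v \<and> vwalk_length p = 0} \<subseteq> {[v]}"
  proof clarify
    fix p assume "vwalk p (cayley_graph G T)" "vwalk_length p = 0"
    then show "p = [hd p]" by (cases p) (auto simp: vwalk_def)
  qed
  then show ?case using finite_subset by blast
next
  case (Suc n)
  let ?W = "\<lambda>v n. {p. vwalk p (cayley_graph G T) \<and> hd p = v \<and> vwalk_length p = n}"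
  have "?W v (Suc n) \<subseteq> (\<Union>t\<in>T. (#) v ` ?W (v \<otimes> t) n)"
  proof
    fix p assume p: "p \<in> ?W v (Suc n)"
    then obtain q where q: "p = v # q" "length q = Suc n" by (cases p) (auto simp: vwalk_def)
    then have "q \<noteq> []" by auto
    note q = q(1) this
    have "(v, hd q) \<in> arcs_ends (cayley_graph G T)" and walk: "vwalk q (cayley_graph G T)"
      using p q vwalk_arcs_Cons[OF q(2), of v] by (force simp: vwalk_def)+
    then obtain t where t: "t \<in> T" "hd q = v \<otimes> t" by (auto simp: arcs_ends_cayley_graph)
    have "q \<in> ?W (v \<otimes> t) n" using p q t walk by simp
    then show "p \<in> (\<Union>t\<in>T. (#) v ` ?W (v \<otimes> t) n)" unfolding q(1) using t(1) by blast
  qed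
  moreover have "finite T" using assms by (simp add: cayley_generators_def)
  ultimately show ?case
    by (intro finite_subset[OF \<open>?W v (Suc n) \<subseteq> _\<close>] finite_UN_I finite_imageI Suc)
qed

lemma finite_vpaths_cayley_graph:
  assumes "cayley_generators G T"
  shows "finite {p. vpath p (cayley_graph G T) \<and> hd p = v \<and> vwalk_length p = n}"
  by (rule finite_subset[OF _ finite_vwalks_cayley_graph[OF assms, of v n]]) (auto simp: vpath_def)

text \<open>Edges are right multiplications by generators, so left multiplication by
  \<open>g\<close> is a graph automorphism.\<close>

lemma vpath_cayley_graph_translate:
  assumes T: "T \<subseteq> carrier G" and g: "g \<in> carrier G" and p: "vpath p (cayley_graph G T)"
  shows "vpath (map ((\<otimes>) g) p) (cayley_graph G T)"
proof -
  have pc: "set p \<subseteq> carrier G" using p by (auto simp: vpath_def vwalk_def)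
  have "(g \<otimes> x, g \<otimes> y) \<in> arcs_ends (cayley_graph G T)"
    if "(x, y) \<in> arcs_ends (cayley_graph G T)" for x y
    using that g T by (auto simp: arcs_ends_cayley_graph m_assoc subset_iff)
  then have "vwalk (map ((\<otimes>) g) p) (cayley_graph G T)"
    using p pc g by (force simp: vpath_def vwalk_def vwalk_arcs_map)
  moreover have "inj_on ((\<otimes>) g) (set p)"
    using pc g by (meson inj_on_multc inj_on_subset inj_on_cmult)
  ultimately show ?thesis using p by (auto simp: vpath_def distinct_map)
qed

text \<open>Left translations act transitively on the vertices; the translation by
  \<open>w \<otimes> inv u\<close> injects the walks from \<open>u\<close> into those from
  \<open>w\<close>, and the roles can be exchanged.\<close>

lemma saw_count_cayley_graph:
  assumes T: "cayley_generators G T" and v: "v \<in> carrier G"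
  shows "saw_count (cayley_graph G T) v n = saw_count (cayley_graph G T) \<one> n"
proof -
  let ?P = "\<lambda>v. {p. vpath p (cayley_graph G T) \<and> hd p = v \<and> vwalk_length p = n}"
  have TG: "T \<subseteq> carrier G" using T by (simp add: cayley_generators_def)
  have le: "card (?P u) \<le> card (?P w)" if u: "u \<in> carrier G" and w: "w \<in> carrier G" for u w
  proof (rule card_inj_on_le)
    let ?g = "w \<otimes> inv u"
    have g: "?g \<in> carrier G" "?g \<otimes> u = w" using u w by (simp_all add: m_assoc)
    show "map ((\<otimes>) ?g) ` ?P u \<subseteq> ?P w"
    proof clarify
      fix p assume p: "vpath p (cayley_graph G T)" "u = hd p" "n = vwalk_length p"
      then have "hd (map ((\<otimes>) ?g) p) = w"
        using g by (subst hd_map) (auto simp: vpath_def vwalk_def)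
      then show "vpath (map ((\<otimes>) (w \<otimes> inv hd p)) p) (cayley_graph G T) \<and>
          hd (map ((\<otimes>) (w \<otimes> inv hd p)) p) = w \<and>
          vwalk_length (map ((\<otimes>) (w \<otimes> inv hd p)) p) = vwalk_length p"
        using vpath_cayley_graph_translate[OF TG g(1) p(1)] p by simp
    qed
    have "inj_on ((\<otimes>) ?g) (carrier G)" using g by (meson inj_on_cmult)
    then show "inj_on (map ((\<otimes>) ?g)) (?P u)"
      by (rule inj_on_subset[OF inj_on_map_lists]) (auto simp: vpath_def vwalk_def subset_iff)
    show "finite (?P w)" by (rule finite_vpaths_cayley_graph[OF T])
  qed
  show ?thesis unfolding saw_count_def using le[OF v one_closed] le[OF one_closed v] by simp
qed

text \<open>Cut a walk after \<open>m\<close> steps. Both pieces keep the cutting vertex, hence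
  \<open>take (Suc m)\<close> and \<open>drop m\<close>; by transitivity the second piece can be
  counted from \<open>v\<close>.\<close>

lemma saw_count_cayley_graph_submultiplicative:
  assumes T: "cayley_generators G T" and v: "v \<in> carrier G"
  shows "saw_count (cayley_graph G T) v (m + n)
    \<le> saw_count (cayley_graph G T) v m * saw_count (cayley_graph G T) v n"
proof -
  let ?P = "\<lambda>v n. {p. vpath p (cayley_graph G T) \<and> hd p = v \<and> vwalk_length p = n}"
  have fin: "finite (?P v n)" for v n by (rule finite_vpaths_cayley_graph[OF T])
  have "card (?P v (m + n)) \<le> card (SIGMA p:?P v m. ?P (last p) n)"
  proof (rule card_inj_on_le)
    show "inj_on (\<lambda>p. (take (Suc m) p, drop m p)) (?P v (m + n))"
    proof (rule inj_onI)
      fix p q assume "(take (Suc m) p, drop m p) = (take (Suc m) q, drop m q)"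
      then have "take m (take (Suc m) p) = take m (take (Suc m) q)" "drop m p = drop m q" by auto
      then have "take m p @ drop m p = take m q @ drop m q" by (simp add: min_def)
      then show "p = q" by simp
    qed
    show "(\<lambda>p. (take (Suc m) p, drop m p)) ` ?P v (m + n) \<subseteq> (SIGMA p:?P v m. ?P (last p) n)"
    proof (rule image_subsetI)
      fix p assume "p \<in> ?P v (m + n)"
      then have p: "vpath p (cayley_graph G T)" "v = hd p" "vwalk_length p = m + n" by auto
      then have len: "length p = Suc (m + n)" by (cases p) (auto simp: vpath_def vwalk_def)
      have "vwalk (take (Suc m) p @ drop (Suc m) p) (cayley_graph G T)"
        "vwalk (take m p @ drop m p) (cayley_graph G T)"
        using p(1) unfolding append_take_drop_id vpath_def by simp_all
      then have "vwalk (take (Suc m) p) (cayley_graph G T)" "vwalk (drop m p) (cayley_graph G T)"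
        using len by (metis vwalkI_append_l take_eq_Nil length_0_conv nat.distinct(1),
            metis vwalkI_append_r drop_eq_Nil not_less_eq_eq le_add1)
      moreover have "hd (take (Suc m) p) = hd p" using len by (cases p) auto
      moreover have "hd (drop m p) = last (take (Suc m) p)"
        using len by (simp add: take_Suc_conv_app_nth hd_drop_conv_nth)
      ultimately show "(take (Suc m) p, drop m p) \<in> (SIGMA q:?P v m. ?P (last q) n)"
        using p len by (auto simp: vpath_def)
    qed
    show "finite (SIGMA p:?P v m. ?P (last p) n)" using fin by (intro finite_SigmaI)
  qed
  also have "\<dots> = (\<Sum>p\<in>?P v m. saw_count (cayley_graph G T) (last p) n)"
    using card_SigmaI[of "?P v m" "\<lambda>p. ?P (last p) n", OF fin] fin
    unfolding saw_count_def by blast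
  also have "\<dots> = (\<Sum>p\<in>?P v m. saw_count (cayley_graph G T) v n)"
  proof (rule sum.cong[OF HOL.refl])
    fix p assume "p \<in> ?P v m"
    then have "last p \<in> carrier G"
      using last_in_set[of p] by (auto simp: vpath_def vwalk_def)
    then show "saw_count (cayley_graph G T) (last p) n = saw_count (cayley_graph G T) v n"
      using saw_count_cayley_graph[OF T] v by metis
  qed
  finally show ?thesis by (simp only: saw_count_def sum_constant of_nat_id)
qed

lemma connective_constant_ge:
  assumes T: "cayley_generators G T" and v: "v \<in> carrier G"
    and K: "0 < K" and c: "0 < c" and lower: "\<And>n. c ^ n * K \<le> real (saw_count (cayley_graph G T) v n)"
  shows "c \<le> connective_constant (cayley_graph G T) v"
  unfolding connective_constant_def
proof (rule lim_root_ge)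
  show "real (saw_count (cayley_graph G T) v (m + n))
    \<le> real (saw_count (cayley_graph G T) v m) * real (saw_count (cayley_graph G T) v n)" for m n
    using saw_count_cayley_graph_submultiplicative[OF T v, of m n]
    by (metis of_nat_mono of_nat_mult)
  show "1 \<le> real (saw_count (cayley_graph G T) v n)" for n
  proof -
    have "0 < c ^ n * K" using c K by simp
    then have "0 < real (saw_count (cayley_graph G T) v n)" using lower[of n] by linarith
    then show ?thesis by simp
  qed
qed (use K c lower in auto)

subsection \<open>Vertex sets with finite boundary\<close>

text \<open>Induction along a word in the generators; as \<open>T\<close> is closed under inverses,
  no separate inverse step arises. Since \<open>generate\<close> multiplies arbitrary generated
  elements, the proof shows that right multiplication of any \<open>y\<close> by \<open>x\<close>
  preserves \<open>P\<close>.\<close>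

lemma cayley_induct [consumes 2, case_names one step]:
  assumes T: "cayley_generators G T" and x: "x \<in> carrier G"
    and one: "P \<one>" and step: "\<And>x t. x \<in> carrier G \<Longrightarrow> t \<in> T \<Longrightarrow> P x \<Longrightarrow> P (x \<otimes> t)"
  shows "P x"
proof -
  have TG: "T \<subseteq> carrier G" and inv: "\<And>t. t \<in> T \<Longrightarrow> inv t \<in> T"
    using T by (auto simp: cayley_generators_def)
  have "x \<in> generate G T" using T x by (simp add: cayley_generators_def)
  then have "\<forall>y\<in>carrier G. P y \<longrightarrow> P (y \<otimes> x)"
  proof (induction rule: generate.induct)
    case (eng h1 h2)
    have "h1 \<in> carrier G" "h2 \<in> carrier G"
      using eng(1,2) generate_in_carrier[OF TG] by auto
    then show ?case using eng by (simp flip: m_assoc)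
  qed (use step inv in auto)
  then show ?thesis using one x by force
qed

text \<open>For symmetric \<open>T\<close> these are the endpoints, on both sides, of the edges
  between \<open>Q\<close> and its complement, so a set and its complement have the same
  boundary.\<close>

definition vertex_boundary :: "'a set \<Rightarrow> 'a set \<Rightarrow> 'a set" where
  "vertex_boundary T Q = {x \<in> carrier G. \<exists>t\<in>T. (x \<in> Q) \<noteq> (x \<otimes> t \<in> Q)}"

lemma vertex_boundaryD:
  "x \<in> carrier G \<Longrightarrow> x \<notin> vertex_boundary T Q \<Longrightarrow> t \<in> T \<Longrightarrow> x \<otimes> t \<in> Q \<longleftrightarrow> x \<in> Q"
  by (auto simp: vertex_boundary_def)

lemma vertex_boundary_compl:
  assumes "T \<subseteq> carrier G"
  shows "vertex_boundary T (carrier G - Q) = vertex_boundary T Q"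
  using assms by (auto simp: vertex_boundary_def subset_iff)

lemma vertex_boundary_Int: "vertex_boundary T (P \<inter> Q) \<subseteq> vertex_boundary T P \<union> vertex_boundary T Q"
  by (auto simp: vertex_boundary_def)

text \<open>The condition \<open>inv g \<otimes> x \<in> Q\<close> describes the left translate of
  \<open>Q\<close> by \<open>g\<close>, and left translation preserves edges.\<close>

lemma vertex_boundary_translate:
  assumes T: "T \<subseteq> carrier G" and g: "g \<in> carrier G"
  shows "vertex_boundary T {x \<in> carrier G. inv g \<otimes> x \<in> Q} \<subseteq> (\<otimes>) g ` vertex_boundary T Q"
proof
  fix x assume "x \<in> vertex_boundary T {x \<in> carrier G. inv g \<otimes> x \<in> Q}"
  then obtain t where x: "x \<in> carrier G" and t: "t \<in> T"
    and ne: "(inv g \<otimes> x \<in> Q) \<noteq> (inv g \<otimes> (x \<otimes> t) \<in> Q)"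
    using T by (auto simp: vertex_boundary_def)
  have "t \<in> carrier G" using t T by auto
  then have "inv g \<otimes> (x \<otimes> t) = inv g \<otimes> x \<otimes> t" using x g by (simp add: m_assoc)
  then have "inv g \<otimes> x \<in> vertex_boundary T Q"
    using x t ne g by (auto simp: vertex_boundary_def)
  moreover have "x = g \<otimes> (inv g \<otimes> x)" using x g by (simp flip: m_assoc)
  ultimately show "x \<in> (\<otimes>) g ` vertex_boundary T Q" by blast
qed

section \<open>Infinite components and ends\<close>

lemma sym_digraph_induced_cayley_graph:
  assumes "cayley_generators G T"
  shows "sym_digraph (cayley_graph G T \<restriction> W)"
proof -
  interpret C: sym_digraph "cayley_graph G T" by (rule cayley_graph_simple(1)[OF assms])
  have "wf_digraph (cayley_graph G T \<restriction> W)"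
    by (rule C.wellformed_induce_subgraph)
  moreover have "symmetric (cayley_graph G T \<restriction> W)"
  proof (unfold symmetric_def, rule symI)
    fix x y assume "(x, y) \<in> arcs_ends (cayley_graph G T \<restriction> W)"
    then have "x \<in> W" "y \<in> W" "(x, y) \<in> arcs_ends (cayley_graph G T)"
      by (auto simp: arcs_ends_def arc_to_ends_def)
    moreover from this have "(y, x) \<in> arcs_ends (cayley_graph G T)" by (metis C.graph_symmetric)
    ultimately show "(y, x) \<in> arcs_ends (cayley_graph G T \<restriction> W)"
      by (force simp: arcs_ends_def arc_to_ends_def image_iff)
  qed
  ultimately show ?thesis by (simp add: wf_digraph.sym_digraphI)
qed

lemma arcs_ends_induced_cayley_graph:
  "(x, y) \<in> arcs_ends (cayley_graph G T \<restriction> W) \<longleftrightarrow>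
    x \<in> carrier G \<and> x \<in> W \<and> y \<in> W \<and> (\<exists>t\<in>T. y = x \<otimes> t)"
  by (auto simp: arcs_ends_def arc_to_ends_def cayley_graph_def image_iff)

text \<open>Once \<open>H\<close> is removed, no edge joins \<open>Q\<close> to its complement. A
  path from \<open>\<one> \<in> H\<close> to a remaining vertex must leave \<open>H\<close>, so
  every remaining component meets the finite set \<open>N\<close> of neighbours of \<open>H\<close>.
  Finitely many components thus cover \<open>Q - H\<close>, and one of them is infinite.\<close>

lemma infinite_component_within:
  assumes T: "cayley_generators G T" and Q: "Q \<subseteq> carrier G" "infinite Q"
    and H: "finite H" "H \<subseteq> carrier G" "\<one> \<in> H" "vertex_boundary T Q \<subseteq> H"
  shows "\<exists>S\<in>pre_digraph.sccs_verts (cayley_graph G T \<restriction> (carrier G - H)). infinite S \<and> S \<subseteq> Q"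
proof -
  let ?D = "cayley_graph G T \<restriction> (carrier G - H)"
  interpret D: sym_digraph ?D by (rule sym_digraph_induced_cayley_graph[OF T])
  have TG: "T \<subseteq> carrier G" "finite T" using T by (auto simp: cayley_generators_def)
  define N where "N = (\<lambda>(h, t). h \<otimes> t) ` (H \<times> T) - H"
  have finN: "finite N" using H TG by (simp add: N_def)
  have reach: "x \<notin> H \<longrightarrow> (\<exists>y\<in>N. y \<rightarrow>\<^sup>*\<^bsub>?D\<^esub> x)" if "x \<in> carrier G" for x
    using T that
  proof (induction rule: cayley_induct)
    case (step x t)
    have t: "t \<in> carrier G" using step TG by auto
    show ?case
    proof (intro impI)
      assume xt: "x \<otimes> t \<notin> H"
      show "\<exists>y\<in>N. y \<rightarrow>\<^sup>*\<^bsub>?D\<^esub> (x \<otimes> t)"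
      proof (cases "x \<in> H")
        case True
        then have "x \<otimes> t \<in> N" using xt step by (auto simp: N_def)
        then show ?thesis using xt step t by (intro bexI[of _ "x \<otimes> t"] D.reachable_refl) auto
      next
        case False
        then obtain y where y: "y \<in> N" "y \<rightarrow>\<^sup>*\<^bsub>?D\<^esub> x" using step by blast
        have "(x, x \<otimes> t) \<in> arcs_ends ?D"
          using False xt step t by (auto simp: arcs_ends_induced_cayley_graph)
        then show ?thesis using y D.reachable_adj_trans by blast
      qed
    qed
  qed (use H in simp)
  have side: "y \<in> Q \<longleftrightarrow> x \<in> Q" if "y \<rightarrow>\<^sup>*\<^bsub>?D\<^esub> x" for x y
    using that
  proof (induction rule: D.reachable_induct)
    case (step x z)
    then have "x \<in> carrier G" "x \<notin> H" "\<exists>t\<in>T. z = x \<otimes> t"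
      by (auto simp: arcs_ends_induced_cayley_graph)
    then have "z \<in> Q \<longleftrightarrow> x \<in> Q" using H vertex_boundaryD[of x T Q] by blast
    then show ?case using step by simp
  qed simp
  have "infinite (Q - H)" using Q H by simp
  moreover have "Q - H \<subseteq> (\<Union>y\<in>N. {x \<in> Q. y \<rightarrow>\<^sup>*\<^bsub>?D\<^esub> x})" using reach Q by blast
  ultimately obtain y where y: "y \<in> N" "infinite {x \<in> Q. y \<rightarrow>\<^sup>*\<^bsub>?D\<^esub> x}"
    using finN by (meson finite_UN_I finite_subset)
  have yQ: "y \<in> Q" using y(2) side by (metis (mono_tags, lifting) Collect_empty_eq finite.emptyI)
  have yD: "y \<in> verts ?D" using yQ Q y(1) by (auto simp: N_def)
  have "D.scc_of y \<in> D.sccs_verts" using yD by (rule D.scc_of_in_sccs_verts)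
  moreover have "{x \<in> Q. y \<rightarrow>\<^sup>*\<^bsub>?D\<^esub> x} \<subseteq> D.scc_of y"
    using D.scc_ofI_reachable' by auto
  then have "infinite (D.scc_of y)" using y(2) by (rule infinite_super)
  moreover have "D.scc_of y \<subseteq> Q" using side yQ by (auto simp: D.scc_of_def)
  ultimately show ?thesis by (intro bexI[of _ "D.scc_of y"] conjI)
qed

text \<open>A finite vertex set enters the supremum through the subgraph that it induces.\<close>

lemma num_infinite_components_le_num_ends:
  assumes T: "cayley_generators G T" and H: "finite H" "H \<subseteq> carrier G"
  shows "num_infinite_components (cayley_graph G T \<restriction> (carrier G - H)) \<le> num_ends (cayley_graph G T)"
proof -
  let ?H = "cayley_graph G T \<restriction> H"
  interpret C: sym_digraph "cayley_graph G T" by (rule cayley_graph_simple(1)[OF T])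
  have wf: "wf_digraph ?H" by (rule C.wellformed_induce_subgraph)
  have "subgraph ?H (cayley_graph G T)"
    using H wf C.wf_digraph_axioms
    by (auto simp: subgraph_def compatible_def cayley_graph_def)
  moreover have "arcs ?H \<subseteq> H \<times> H" by (auto simp: cayley_graph_def)
  then have "finite (arcs ?H)" using H by (meson finite_SigmaI finite_subset)
  then have "fin_digraph ?H"
    using wf H by (simp add: fin_digraph_def fin_digraph_axioms_def)
  ultimately have "num_infinite_components (cayley_graph G T \<restriction> (verts (cayley_graph G T) - verts ?H))
    \<le> num_ends (cayley_graph G T)"
    unfolding num_ends_def by (intro SUP_upper) simp
  then show ?thesis by (simp add: cayley_graph_def)
qed

text \<open>Removing the three boundaries together leaves an infinite component inside each of the
  disjoint sets, one more than two ends allow.\<close>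

lemma not_three_disjoint_infinite:
  assumes T: "cayley_generators G T" and ends: "num_ends (cayley_graph G T) = 2"
    and Q: "\<And>i. i < (3::nat) \<Longrightarrow> Q i \<subseteq> carrier G \<and> infinite (Q i) \<and> finite (vertex_boundary T (Q i))"
    and disj: "\<And>i j. i < j \<Longrightarrow> j < 3 \<Longrightarrow> Q i \<inter> Q j = {}"
  shows False
proof -
  define H where "H = insert \<one> (\<Union>i<3. vertex_boundary T (Q i))"
  let ?D = "cayley_graph G T \<restriction> (carrier G - H)"
  interpret D: sym_digraph ?D by (rule sym_digraph_induced_cayley_graph[OF T])
  have H: "finite H" "H \<subseteq> carrier G" "\<one> \<in> H" "\<And>i. i < 3 \<Longrightarrow> vertex_boundary T (Q i) \<subseteq> H"
    using Q by (auto simp: H_def vertex_boundary_def)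
  have "\<exists>S. S \<in> D.sccs_verts \<and> infinite S \<and> S \<subseteq> Q i" if "i < 3" for i
    using infinite_component_within[OF T _ _ H(1-3)] Q[OF that] H(4)[OF that] by blast
  then obtain S where S: "\<And>i. i < 3 \<Longrightarrow> S i \<in> D.sccs_verts \<and> infinite (S i) \<and> S i \<subseteq> Q i"
    by metis
  define K where "K i = ?D \<restriction> S i" for i
  have "verts (K i) = S i" for i by (simp add: K_def)
  have "S i \<noteq> S j" if "i < j" "j < 3" for i j
    using S[of i] S[of j] disj[OF that] that by (metis Int_absorb finite.emptyI le_inf_iff
        less_trans subset_antisym Int_mono order_refl empty_subsetI inf.orderE)
  then have "inj_on S {..<3}" by (intro linorder_inj_onI) auto
  then have inj: "inj_on K {..<3}"
    using \<open>\<And>i. verts (K i) = S i\<close> by (metis inj_on_def)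
  have "K ` {..<3} \<subseteq> infinite_components ?D"
    using S by (auto simp: infinite_components_def K_def D.in_sccs_verts_conv)
  then have "3 \<le> card (infinite_components ?D)" if "finite (infinite_components ?D)"
    using card_mono[OF that \<open>K ` _ \<subseteq> _\<close>] card_image[OF inj] by simp
  then have "3 \<le> num_infinite_components ?D"
    by (auto simp: num_infinite_components_def numeral_eq_enat)
  also have "\<dots> \<le> 2"
    using num_infinite_components_le_num_ends[OF T H(1,2)] ends by simp
  finally show False by (simp add: numeral_eq_enat)
qed

text \<open>More than one end means that some finite \<open>H\<close> leaves two infinite
  components. One of them is \<open>E\<close>, the other makes the complement infinite, and every
  edge leaving \<open>E\<close> has an endpoint in \<open>H\<close>.\<close>

lemma ex_infinite_coinfinite:
  assumes T: "cayley_generators G T" and ends: "num_ends (cayley_graph G T) = 2"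
  shows "\<exists>E\<subseteq>carrier G. infinite E \<and> infinite (carrier G - E) \<and> finite (vertex_boundary T E)"
proof -
  let ?C = "cayley_graph G T"
  have TG: "T \<subseteq> carrier G" "finite T" using T by (auto simp: cayley_generators_def)
  have "\<exists>H. subgraph H ?C \<and> fin_digraph H \<and>
      \<not> num_infinite_components (?C \<restriction> (verts ?C - verts H)) \<le> 1"
  proof (rule ccontr)
    assume "\<not> ?thesis"
    then have "num_ends ?C \<le> 1" unfolding num_ends_def by (intro SUP_least) auto
    then show False using ends by simp
  qed
  then obtain H where H: "subgraph H ?C" "fin_digraph H"
    "\<not> num_infinite_components (?C \<restriction> (verts ?C - verts H)) \<le> 1" by blast
  let ?D = "?C \<restriction> (verts ?C - verts H)"
  interpret D: sym_digraph ?D by (rule sym_digraph_induced_cayley_graph[OF T])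
  have "\<exists>C1\<in>infinite_components ?D. \<exists>C2\<in>infinite_components ?D. C1 \<noteq> C2"
  proof (rule ccontr)
    assume "\<not> ?thesis"
    then have "infinite_components ?D = {} \<or> (\<exists>C. infinite_components ?D = {C})" by blast
    then have "finite (infinite_components ?D) \<and> card (infinite_components ?D) \<le> 1" by auto
    then show False using H(3) by (auto simp: num_infinite_components_def one_enat_def)
  qed
  then obtain C1 C2 where C: "C1 \<in> D.sccs" "infinite (verts C1)" "C2 \<in> D.sccs" "infinite (verts C2)"
    "C1 \<noteq> C2" by (auto simp: infinite_components_def)
  let ?E = "verts C1"
  have E: "?E \<in> D.sccs_verts" "verts C2 \<in> D.sccs_verts"
    unfolding D.sccs_verts_conv using C by blast+
  have "?E \<noteq> verts C2" using C D.inj_on_verts_sccs by (auto simp: inj_on_def)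
  then have disj: "?E \<inter> verts C2 = {}" using D.sccs_verts_disjoint E by blast
  have sub: "?E \<subseteq> carrier G" "verts C2 \<subseteq> carrier G"
    using D.sccs_verts_subsets E by (force simp: cayley_graph_def)+
  have finH: "finite (verts H)" using H(2) by (rule fin_digraph.finite_verts)
  have same: "x \<otimes> t \<in> ?E \<longleftrightarrow> x \<in> ?E"
    if "x \<in> carrier G" "t \<in> T" "x \<notin> verts H" "x \<otimes> t \<notin> verts H" for x t
  proof -
    have "(x, x \<otimes> t) \<in> arcs_ends ?D"
      unfolding arcs_ends_induced_cayley_graph using that TG by (auto simp: cayley_graph_def)
    then have "x \<rightarrow>\<^sup>*\<^bsub>?D\<^esub> (x \<otimes> t)" "(x \<otimes> t) \<rightarrow>\<^sup>*\<^bsub>?D\<^esub> x"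
      using D.graph_symmetric by blast+
    then show ?thesis using E(1) unfolding D.in_sccs_verts_conv_reachable by blast
  qed
  have "vertex_boundary T ?E \<subseteq> verts H \<union> (\<lambda>(h, t). h \<otimes> inv t) ` (verts H \<times> T)"
  proof
    fix x assume "x \<in> vertex_boundary T ?E"
    then obtain t where x: "x \<in> carrier G" and t: "t \<in> T" and "(x \<in> ?E) \<noteq> (x \<otimes> t \<in> ?E)"
      by (auto simp: vertex_boundary_def)
    then have "x \<in> verts H \<or> x \<otimes> t \<in> verts H" using same by blast
    moreover have "x = x \<otimes> t \<otimes> inv t" using x t TG by (auto simp: m_assoc)
    ultimately show "x \<in> verts H \<union> (\<lambda>(h, t). h \<otimes> inv t) ` (verts H \<times> T)"
      using t by (force simp: image_iff)
  qed
  then have "finite (vertex_boundary T ?E)" using finH TG by (meson finite_SigmaI finite_UnI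
        finite_imageI finite_subset)
  moreover have "infinite (carrier G - ?E)"
    using C(4) disj sub by (metis Diff_eq_empty_iff Int_commute Diff_triv Diff_mono finite_subset order_refl)
  ultimately show ?thesis using C(2) sub by blast
qed

text \<open>\<open>E\<close> and its translate cut the group into four disjoint corners with finite
  boundary. If both alternatives failed, three corners would be infinite, which two ends
  exclude.\<close>

lemma translate_or_compl:
  assumes T: "cayley_generators G T" and ends: "num_ends (cayley_graph G T) = 2"
    and E: "E \<subseteq> carrier G" "infinite E" "infinite (carrier G - E)" "finite (vertex_boundary T E)"
    and g: "g \<in> carrier G"
  shows "finite {x \<in> carrier G. (inv g \<otimes> x \<in> E) \<noteq> (x \<in> E)} \<or>
    finite {x \<in> carrier G. (inv g \<otimes> x \<in> E) = (x \<in> E)}"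
proof (rule ccontr)
  assume neg: "\<not> ?thesis"
  have TG: "T \<subseteq> carrier G" using T by (auto simp: cayley_generators_def)
  let ?F = "{x \<in> carrier G. inv g \<otimes> x \<in> E}"
  define Q where "Q a b = (if a then E else carrier G - E) \<inter> (if b then ?F else carrier G - ?F)"
    for a b
  have finF: "finite (vertex_boundary T ?F)"
    using vertex_boundary_translate[OF TG g, of E] E(4) by (meson finite_imageI finite_subset)
  have bd: "finite (vertex_boundary T (Q a b))" for a b
    using vertex_boundary_Int[of T "if a then E else carrier G - E" "if b then ?F else carrier G - ?F"]
      vertex_boundary_compl[OF TG, of E] vertex_boundary_compl[OF TG, of ?F] E(4) finF
    unfolding Q_def by (cases a; cases b; simp; meson finite_UnI finite_subset)
  have sub: "Q a b \<subseteq> carrier G" for a b using E(1) by (auto simp: Q_def)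
  have transl: "infinite {x \<in> carrier G. inv g \<otimes> x \<in> A}" if "A \<subseteq> carrier G" "infinite A" for A
  proof
    assume "finite {x \<in> carrier G. inv g \<otimes> x \<in> A}"
    moreover have "A \<subseteq> (\<lambda>x. inv g \<otimes> x) ` {x \<in> carrier G. inv g \<otimes> x \<in> A}"
    proof
      fix a assume a: "a \<in> A"
      then have "a = inv g \<otimes> (g \<otimes> a)" using that g by (auto simp flip: m_assoc)
      then show "a \<in> (\<lambda>x. inv g \<otimes> x) ` {x \<in> carrier G. inv g \<otimes> x \<in> A}"
        using a that g by (intro image_eqI[of _ _ "g \<otimes> a"]) auto
    qed
    ultimately show False using that(2) by (meson finite_imageI finite_subset)
  qed
  have "{x \<in> carrier G. (inv g \<otimes> x \<in> E) \<noteq> (x \<in> E)} = Q True False \<union> Q False True"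
    "{x \<in> carrier G. (inv g \<otimes> x \<in> E) = (x \<in> E)} = Q True True \<union> Q False False"
    "E = Q True True \<union> Q True False" "carrier G - E = Q False True \<union> Q False False"
    "?F = Q True True \<union> Q False True"
    "{x \<in> carrier G. inv g \<otimes> x \<in> carrier G - E} = Q True False \<union> Q False False"
    using E(1) g by (auto simp: Q_def)
  \<comment> \<open>These six disjunctions leave at least three of the four corners infinite.\<close>
  then have inf: "infinite (Q True False) \<or> infinite (Q False True)"
    "infinite (Q True True) \<or> infinite (Q False False)"
    "infinite (Q True True) \<or> infinite (Q True False)"
    "infinite (Q False True) \<or> infinite (Q False False)"
    "infinite (Q True True) \<or> infinite (Q False True)"
    "infinite (Q True False) \<or> infinite (Q False False)"
    using neg E(2,3) transl[OF E(1,2)] transl[OF _ E(3)] by (metis finite_UnI Diff_subset)+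
  have False if "infinite (Q (fst p) (snd p))" "infinite (Q (fst q) (snd q))" "infinite (Q (fst r) (snd r))"
    "p \<noteq> q" "q \<noteq> r" "p \<noteq> r" for p q r
  proof -
    have disj: "Q (fst p) (snd p) \<inter> Q (fst q) (snd q) = {}" if "p \<noteq> q" for p q
      using that by (cases p; cases q) (auto simp: Q_def)
    let ?Q = "\<lambda>i::nat. if i = 0 then Q (fst p) (snd p) else if i = 1 then Q (fst q) (snd q) else Q (fst r) (snd r)"
    show False
    proof (rule not_three_disjoint_infinite[OF T ends, of ?Q])
      show "?Q i \<inter> ?Q j = {}" if ij: "i < j" "j < 3" for i j
      proof -
        consider "i = 0" "j = 1" | "i = 0" "j = 2" | "i = 1" "j = 2" using ij by linarith
        then show ?thesis using disj \<open>p \<noteq> q\<close> \<open>q \<noteq> r\<close> \<open>p \<noteq> r\<close> by cases auto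
      qed
    qed (use that bd sub in auto)
  qed
  from this[of "(True, True)" "(True, False)" "(False, True)"]
    this[of "(True, True)" "(True, False)" "(False, False)"]
    this[of "(True, True)" "(False, True)" "(False, False)"]
    this[of "(True, False)" "(False, True)" "(False, False)"]
  show False using inf by auto
qed

section \<open>Nested translates\<close>

text \<open>The last condition expresses connectedness of \<open>B\<close> without paths: whatever
  is constant along the edges inside \<open>B\<close> is constant on \<open>B\<close>. Such sets may
  be enlarged by a neighbour, and two of them may be united as they share
  \<open>\<one>\<close>.\<close>

lemma ex_finite_connected_superset:
  assumes T: "cayley_generators G T" and K: "finite K" "K \<subseteq> carrier G"
  shows "\<exists>B. finite B \<and> B \<subseteq> carrier G \<and> \<one> \<in> B \<and> K \<subseteq> B \<and>
    (\<forall>P :: 'a \<Rightarrow> bool. (\<forall>x\<in>B. \<forall>t\<in>T. x \<otimes> t \<in> B \<longrightarrow> P (x \<otimes> t) = P x) \<longrightarrow> (\<forall>x\<in>B. P x = P \<one>))"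
proof -
  define conn where "conn B \<longleftrightarrow> finite B \<and> B \<subseteq> carrier G \<and> \<one> \<in> B \<and>
    (\<forall>P :: 'a \<Rightarrow> bool. (\<forall>x\<in>B. \<forall>t\<in>T. x \<otimes> t \<in> B \<longrightarrow> P (x \<otimes> t) = P x) \<longrightarrow> (\<forall>x\<in>B. P x = P \<one>))" for B
  have connD: "P y = P \<one>"
    if "conn B" "y \<in> B" "\<And>x t. x \<in> B \<Longrightarrow> t \<in> T \<Longrightarrow> x \<otimes> t \<in> B \<Longrightarrow> P (x \<otimes> t) = P x"
    for B y and P :: "'a \<Rightarrow> bool"
    using that(1)[unfolded conn_def, THEN conjunct2, THEN conjunct2, THEN conjunct2, THEN spec, of P]
      that(2,3) by simp
  have connI: "conn B" if "finite B" "B \<subseteq> carrier G" "\<one> \<in> B"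
    "\<And>(P :: 'a \<Rightarrow> bool) y. y \<in> B \<Longrightarrow> (\<And>x t. x \<in> B \<Longrightarrow> t \<in> T \<Longrightarrow> x \<otimes> t \<in> B \<Longrightarrow> P (x \<otimes> t) = P x) \<Longrightarrow> P y = P \<one>" for B
    unfolding conn_def
  proof (intro conjI allI impI ballI)
    fix P :: "'a \<Rightarrow> bool" and y
    assume "\<forall>x\<in>B. \<forall>t\<in>T. x \<otimes> t \<in> B \<longrightarrow> P (x \<otimes> t) = P x" "y \<in> B"
    then show "P y = P \<one>" by (intro that(4)) simp_all
  qed (rule that(1-3))+
  have basic: "finite B" "B \<subseteq> carrier G" "\<one> \<in> B" if "conn B" for B
    using that by (simp_all add: conn_def)
  have TG: "T \<subseteq> carrier G" using T by (auto simp: cayley_generators_def)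
  have single: "\<exists>B. conn B \<and> k \<in> B" if "k \<in> carrier G" for k
    using T that
  proof (induction rule: cayley_induct)
    case one
    have "conn {\<one>}" by (rule connI) auto
    then show ?case by blast
  next
    case (step x t)
    then obtain B where B: "conn B" "x \<in> B" by blast
    have "conn (insert (x \<otimes> t) B)"
    proof (rule connI)
      fix P :: "'a \<Rightarrow> bool" and y assume y: "y \<in> insert (x \<otimes> t) B"
        and P: "\<And>z s. z \<in> insert (x \<otimes> t) B \<Longrightarrow> s \<in> T \<Longrightarrow> z \<otimes> s \<in> insert (x \<otimes> t) B
          \<Longrightarrow> P (z \<otimes> s) = P z"
      have *: "P z = P \<one>" if "z \<in> B" for z
        by (rule connD[OF B(1) that]) (simp add: P)
      have "P (x \<otimes> t) = P x" using B step(2) by (simp add: P)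
      then show "P y = P \<one>" using * y B by auto
    qed (use basic[OF B(1)] step TG in auto)
    then show ?case by blast
  qed
  have "\<exists>B. conn B \<and> K \<subseteq> B" using K
  proof (induction K)
    case empty
    then show ?case using single[of \<one>] by auto
  next
    case (insert k K)
    then obtain B1 B2 where B: "conn B1" "K \<subseteq> B1" "conn B2" "k \<in> B2" using single[of k] by auto
    have "conn (B1 \<union> B2)"
    proof (rule connI)
      fix P :: "'a \<Rightarrow> bool" and y assume "y \<in> B1 \<union> B2"
        and P: "\<And>z s. z \<in> B1 \<union> B2 \<Longrightarrow> s \<in> T \<Longrightarrow> z \<otimes> s \<in> B1 \<union> B2 \<Longrightarrow> P (z \<otimes> s) = P z"
      then consider "y \<in> B1" | "y \<in> B2" by blast
      then show "P y = P \<one>"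
        by cases (rule connD[OF B(1)] connD[OF B(3)]; simp add: P)+
    qed (use basic[OF B(1)] basic[OF B(3)] in auto)
    then show ?case using B by blast
  qed
  then show ?thesis unfolding conn_def by (elim exE conjE) (intro exI conjI)
qed

text \<open>A far away \<open>g \<in> E\<close> carries the boundary of \<open>E\<close> into
  \<open>E\<close>, so the complement of \<open>E\<close> lies on one side of the translated
  partition and the other side lies properly inside \<open>E\<close>. The Boolean \<open>b\<close>
  records whether this inner side is the translate of \<open>E\<close> or of its complement.\<close>

lemma ex_nested_translate:
  assumes T: "cayley_generators G T"
    and E: "E \<subseteq> carrier G" "infinite E" "finite (vertex_boundary T E)"
  shows "\<exists>g\<in>carrier G. \<exists>b. (\<forall>x\<in>carrier G. (inv g \<otimes> x \<in> E) = b \<longrightarrow> x \<in> E) \<and>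
    (\<exists>x\<in>E. (inv g \<otimes> x \<in> E) \<noteq> b)"
proof -
  have TG: "T \<subseteq> carrier G" and Tinv: "\<And>t. t \<in> T \<Longrightarrow> inv t \<in> T"
    using T by (auto simp: cayley_generators_def)
  obtain e where e: "e \<in> E" using E(2) by (metis ex_in_conv finite.emptyI)
  have K: "finite (insert e (vertex_boundary T E))" "insert e (vertex_boundary T E) \<subseteq> carrier G"
    using e E by (auto simp: vertex_boundary_def)
  obtain B where B: "finite B" "B \<subseteq> carrier G" "\<one> \<in> B" "insert e (vertex_boundary T E) \<subseteq> B"
    and conn: "\<forall>P :: 'a \<Rightarrow> bool. (\<forall>x\<in>B. \<forall>t\<in>T. x \<otimes> t \<in> B \<longrightarrow> P (x \<otimes> t) = P x) \<longrightarrow> (\<forall>x\<in>B. P x = P \<one>)"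
    using ex_finite_connected_superset[OF T K] by blast
  \<comment> \<open>Avoiding the finitely many quotients \<open>x \<otimes> inv y\<close> makes
    \<open>B\<close> disjoint from its translates by \<open>g\<close> and by
    \<open>inv g\<close>.\<close>
  have "infinite (E - (\<lambda>(x, y). x \<otimes> inv y) ` (B \<times> B))" using E(2) B(1) by simp
  then obtain g where g: "g \<in> E" "g \<notin> (\<lambda>(x, y). x \<otimes> inv y) ` (B \<times> B)"
    by (metis DiffE ex_in_conv finite.emptyI)
  have gG: "g \<in> carrier G" using g E by auto
  have far: "g \<otimes> x \<notin> B" if "x \<in> B" for x
  proof
    assume "g \<otimes> x \<in> B"
    moreover have "g = (g \<otimes> x) \<otimes> inv x" using gG that B by (auto simp: m_assoc)
    ultimately show False using g(2) that by force
  qed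
  have far': "inv g \<otimes> x \<notin> B" if "x \<in> B" for x
  proof
    assume "inv g \<otimes> x \<in> B"
    moreover have "x = g \<otimes> (inv g \<otimes> x)" using gG that B by (auto simp flip: m_assoc)
    ultimately show False using far that by metis
  qed
  \<comment> \<open>The translate of \<open>B\<close> by \<open>g\<close> is connected and avoids
    the boundary of \<open>E\<close>, so it lies on the side of its member \<open>g\<close>. In the
    same way the translate by \<open>inv g\<close> lies on one side, recorded as
    \<open>b\<close>.\<close>
  have gB: "g \<otimes> x \<in> E" if "x \<in> B" for x
  proof -
    have "\<forall>x\<in>B. (g \<otimes> x \<in> E) = (g \<otimes> \<one> \<in> E)"
    proof (rule conn[THEN spec, of "\<lambda>x. g \<otimes> x \<in> E", THEN mp], intro ballI impI)
      fix x t assume "x \<in> B" "t \<in> T"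
      then show "(g \<otimes> (x \<otimes> t) \<in> E) = (g \<otimes> x \<in> E)"
        using vertex_boundaryD[of "g \<otimes> x" T E t] far[of x] B TG gG by (auto simp: m_assoc subset_iff)
    qed
    then show ?thesis using that g gG by simp
  qed
  define b where "b = (inv g \<in> E)"
  have bB: "(inv g \<otimes> x \<in> E) = b" if "x \<in> B" for x
  proof -
    have "\<forall>x\<in>B. (inv g \<otimes> x \<in> E) = (inv g \<otimes> \<one> \<in> E)"
    proof (rule conn[THEN spec, of "\<lambda>x. inv g \<otimes> x \<in> E", THEN mp], intro ballI impI)
      fix x t assume "x \<in> B" "t \<in> T"
      then show "(inv g \<otimes> (x \<otimes> t) \<in> E) = (inv g \<otimes> x \<in> E)"
        using vertex_boundaryD[of "inv g \<otimes> x" T E t] far'[of x] B TG gG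
        by (auto simp: m_assoc subset_iff)
    qed
    then show ?thesis using that gG by (simp add: b_def)
  qed
  \<comment> \<open>A path changes sides of the translated partition only at vertices of the
    translate of \<open>B\<close> by \<open>g\<close>, all of which lie in \<open>E\<close>; and it
    leaves \<open>E\<close> only into \<open>B\<close>, where the side is \<open>b\<close>.\<close>
  have outside: "x \<notin> E \<longrightarrow> (inv g \<otimes> x \<in> E) = b" if "x \<in> carrier G" for x
    using T that
  proof (induction rule: cayley_induct)
    case one
    then show ?case using bB[OF B(3)] by simp
  next
    case (step x t)
    have t: "t \<in> carrier G" "inv t \<in> T" using step TG Tinv by auto
    show ?case
    proof (cases "x \<otimes> t \<in> B")
      case True
      then show ?thesis using bB by simp
    next
      case False
      show ?thesis
      proof
        assume xt: "x \<otimes> t \<notin> E"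
        have "x \<otimes> t \<notin> vertex_boundary T E" using False B by auto
        then have xE: "x \<notin> E"
          using vertex_boundaryD[of "x \<otimes> t" T E "inv t"] xt step t by (auto simp: m_assoc)
        have "inv g \<otimes> x \<notin> vertex_boundary T E"
        proof
          assume "inv g \<otimes> x \<in> vertex_boundary T E"
          then have "g \<otimes> (inv g \<otimes> x) \<in> E" using B gB by auto
          then show False using xE step gG by (simp flip: m_assoc)
        qed
        then show "(inv g \<otimes> (x \<otimes> t) \<in> E) = b"
          using vertex_boundaryD[of "inv g \<otimes> x" T E t] step t gG xE by (auto simp: m_assoc)
      qed
    qed
  qed
  \<comment> \<open>The inner side is thus \<open>\<not> b\<close>; the point \<open>e\<close> of
    \<open>E\<close> is on side \<open>b\<close> and makes the inclusion proper.\<close>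
  have "(inv g \<otimes> e \<in> E) = b" using bB B by auto
  then have "\<exists>x\<in>E. (inv g \<otimes> x \<in> E) \<noteq> (\<not> b)" using e by auto
  then show ?thesis using outside gG by (intro bexI[of _ g] exI[of _ "\<not> b"]) auto
qed


subsection \<open>The affine action of a two-ended group\<close>

text \<open>\<open>\<epsilon> g\<close> tells whether \<open>g\<close> preserves \<open>E\<close> or
  exchanges it with its complement up to finitely many vertices, and \<open>\<tau> g\<close> is
  twice the signed count of the discrepancy, since \<open>F\<close> takes the values 1 and -1. The
  two signs of \<open>\<tau>\<close> come from nested translates inside \<open>E\<close> and inside
  its complement.\<close>

lemma ex_affine_action:
  assumes T: "cayley_generators G T" and ends: "num_ends (cayley_graph G T) = 2"
  shows "\<exists>(\<epsilon> :: 'a \<Rightarrow> real) \<tau>. (\<forall>g\<in>carrier G. \<epsilon> g = 1 \<or> \<epsilon> g = - 1) \<and>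
    (\<forall>g\<in>carrier G. \<forall>h\<in>carrier G. \<epsilon> (g \<otimes> h) = \<epsilon> g * \<epsilon> h \<and> \<tau> (g \<otimes> h) = \<epsilon> g * \<tau> h + \<tau> g) \<and>
    (\<exists>g\<in>carrier G. \<tau> g < 0) \<and> (\<exists>g\<in>carrier G. 0 < \<tau> g)"
proof -
  obtain E where E: "E \<subseteq> carrier G" "infinite E" "infinite (carrier G - E)"
    "finite (vertex_boundary T E)"
    using ex_infinite_coinfinite[OF T ends] by blast
  define F :: "'a \<Rightarrow> real" where "F x = (if x \<in> E then 1 else - 1)" for x
  have F: "F x = 1 \<or> F x = - 1" for x by (simp add: F_def)
  define \<epsilon> :: "'a \<Rightarrow> real" where
    "\<epsilon> g = (if finite {x \<in> carrier G. (inv g \<otimes> x \<in> E) \<noteq> (x \<in> E)} then 1 else - 1)" for g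
  define D where "D g x = \<epsilon> g * F (inv g \<otimes> x) - F x" for g x
  define W where "W g = {x \<in> carrier G. D g x \<noteq> 0}" for g
  define \<tau> where "\<tau> g = (\<Sum>x\<in>W g. D g x)" for g
  have eps: "\<epsilon> g = 1 \<or> \<epsilon> g = - 1" for g by (simp add: \<epsilon>_def)
  have finW: "finite (W g)" if g: "g \<in> carrier G" for g
  proof (cases "finite {x \<in> carrier G. (inv g \<otimes> x \<in> E) \<noteq> (x \<in> E)}")
    case True
    then have "W g = {x \<in> carrier G. (inv g \<otimes> x \<in> E) \<noteq> (x \<in> E)}"
      by (auto simp: W_def D_def \<epsilon>_def F_def)
    then show ?thesis using True by simp
  next
    case False
    then have "W g = {x \<in> carrier G. (inv g \<otimes> x \<in> E) = (x \<in> E)}"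
      by (auto simp: W_def D_def \<epsilon>_def F_def)
    then show ?thesis using False translate_or_compl[OF T ends E g] by simp
  qed
  \<comment> \<open>Since \<open>F\<close> never vanishes, at most one sign can make the signed
    translate agree with \<open>F\<close> almost everywhere on an infinite set.\<close>
  have uniq: "s = \<epsilon> g" if g: "g \<in> carrier G" and s: "s = 1 \<or> s = - 1"
    and fin: "finite {x \<in> A. s * F (inv g \<otimes> x) \<noteq> F x}" and A: "A \<subseteq> carrier G" "infinite A" for g s A
  proof (rule ccontr)
    assume "s \<noteq> \<epsilon> g"
    then have "s = - \<epsilon> g" using s eps[of g] by auto
    have "A \<subseteq> W g \<union> {x \<in> A. s * F (inv g \<otimes> x) \<noteq> F x}"
    proof
      fix x assume "x \<in> A"
      moreover have "F x \<noteq> 0" using F[of x] by auto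
      ultimately show "x \<in> W g \<union> {x \<in> A. s * F (inv g \<otimes> x) \<noteq> F x}"
        using A \<open>s = - \<epsilon> g\<close> by (cases "x \<in> W g") (auto simp: W_def D_def)
    qed
    then show False using A(2) fin finW[OF g] by (meson finite_UnI finite_subset)
  qed
  have sum_D: "\<tau> g = (\<Sum>x\<in>V. D g x)" if "finite V" "W g \<subseteq> V" "V \<subseteq> carrier G" for g V
    unfolding \<tau>_def using that by (intro sum.mono_neutral_left) (auto simp: W_def)
  have cocycle: "\<epsilon> (g \<otimes> h) = \<epsilon> g * \<epsilon> h \<and> \<tau> (g \<otimes> h) = \<epsilon> g * \<tau> h + \<tau> g"
    if g: "g \<in> carrier G" and h: "h \<in> carrier G" for g h
  proof -
    let ?V = "W (g \<otimes> h) \<union> W g \<union> (\<otimes>) g ` W h"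
    have WG: "W k \<subseteq> carrier G" for k by (auto simp: W_def)
    have V: "finite ?V" "?V \<subseteq> carrier G" using finW g h WG by auto
    have inv_gh: "inv (g \<otimes> h) \<otimes> x = inv h \<otimes> (inv g \<otimes> x)" if "x \<in> carrier G" for x
      using g h that by (simp add: inv_mult_group m_assoc)
    have gg: "g \<otimes> (inv g \<otimes> x) = x" "inv g \<otimes> (g \<otimes> x) = x" if "x \<in> carrier G" for x
      using g that by (simp_all flip: m_assoc)
    \<comment> \<open>Insert \<open>\<epsilon> g * F (inv g \<otimes> x)\<close> as intermediate
      term; summing over a common finite support and reindexing by \<open>g\<close> gives the rule
      for \<open>\<tau>\<close>.\<close>
    have D_gh: "\<epsilon> g * \<epsilon> h * F (inv (g \<otimes> h) \<otimes> x) - F x = \<epsilon> g * D h (inv g \<otimes> x) + D g x"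
      if "x \<in> carrier G" for x
      using that by (simp add: D_def inv_gh algebra_simps)
    have in_gW: "x \<in> (\<otimes>) g ` W h" if "x \<in> carrier G" "D h (inv g \<otimes> x) \<noteq> 0" for x
      using that g gg(1)[OF that(1)] by (intro image_eqI[of _ _ "inv g \<otimes> x"]) (auto simp: W_def)
    have "{x \<in> carrier G. \<epsilon> g * \<epsilon> h * F (inv (g \<otimes> h) \<otimes> x) \<noteq> F x} \<subseteq> W g \<union> (\<otimes>) g ` W h"
      using D_gh in_gW by (force simp: W_def)
    then have "finite {x \<in> carrier G. \<epsilon> g * \<epsilon> h * F (inv (g \<otimes> h) \<otimes> x) \<noteq> F x}"
      using finW g h by (meson finite_UnI finite_imageI finite_subset)
    moreover have "infinite (carrier G)" using E(1,2) finite_subset by blast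
    ultimately have eps_gh: "\<epsilon> g * \<epsilon> h = \<epsilon> (g \<otimes> h)"
      using g h eps[of g] eps[of h] by (intro uniq[of _ _ "carrier G"]) auto
    have "\<tau> (g \<otimes> h) = (\<Sum>x\<in>?V. D (g \<otimes> h) x)" by (intro sum_D V) auto
    also have "\<dots> = (\<Sum>x\<in>?V. \<epsilon> g * D h (inv g \<otimes> x) + D g x)"
    proof (rule sum.cong)
      fix x assume "x \<in> ?V"
      then have "x \<in> carrier G" using V by blast
      then show "D (g \<otimes> h) x = \<epsilon> g * D h (inv g \<otimes> x) + D g x"
        using D_gh eps_gh unfolding D_def[of "g \<otimes> h"] by simp
    qed simp
    also have "\<dots> = \<epsilon> g * (\<Sum>x\<in>?V. D h (inv g \<otimes> x)) + (\<Sum>x\<in>?V. D g x)"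
      by (simp add: sum.distrib sum_distrib_left)
    also have "(\<Sum>x\<in>?V. D h (inv g \<otimes> x)) = (\<Sum>y\<in>(\<otimes>) (inv g) ` ?V. D h y)"
    proof (rule sum.reindex[symmetric, unfolded o_def])
      show "inj_on ((\<otimes>) (inv g)) ?V"
        using V g by (meson inj_on_cmult inj_on_subset inv_closed)
    qed
    also have "\<dots> = \<tau> h"
    proof (rule sum_D[symmetric])
      show "W h \<subseteq> (\<otimes>) (inv g) ` ?V"
      proof
        fix y assume y: "y \<in> W h"
        then have "inv g \<otimes> (g \<otimes> y) = y" using WG gg by blast
        then show "y \<in> (\<otimes>) (inv g) ` ?V" using y by (intro image_eqI[of _ _ "g \<otimes> y"]) auto
      qed
    qed (use V g in auto)
    also have "(\<Sum>x\<in>?V. D g x) = \<tau> g" by (rule sum_D[symmetric]) (use V in auto)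
    finally show ?thesis using eps_gh by simp
  qed
  \<comment> \<open>\<open>\<sigma>\<close> treats \<open>E\<close> and its complement alike. Where
    \<open>\<sigma> * F x\<close> takes its least value -1 the inequality is an equality; this set
    is infinite, which forces \<open>s = \<epsilon> g\<close>. Then
    \<open>\<sigma> * \<tau> g\<close> is a sum of nonpositive terms, one of them negative.\<close>
  have sign: "\<sigma> * \<tau> g < 0"
    if g: "g \<in> carrier G" and \<sigma>: "\<sigma> = 1 \<or> \<sigma> = - 1" and s: "s = 1 \<or> s = - 1"
      and le: "\<And>x. x \<in> carrier G \<Longrightarrow> \<sigma> * (s * F (inv g \<otimes> x)) \<le> \<sigma> * F x"
      and y: "y \<in> carrier G" "\<sigma> * (s * F (inv g \<otimes> y)) \<noteq> \<sigma> * F y"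
      and inf: "infinite {x \<in> carrier G. \<sigma> * F x = - 1}" for \<sigma> g s y
  proof -
    have "{x \<in> {x \<in> carrier G. \<sigma> * F x = - 1}. s * F (inv g \<otimes> x) \<noteq> F x} = {}"
    proof (rule equals0I, clarify)
      fix x assume x: "x \<in> carrier G" "\<sigma> * F x = - 1" "s * F (inv g \<otimes> x) \<noteq> F x"
      then show False using le[OF x(1)] \<sigma> s F[of x] F[of "inv g \<otimes> x"] by auto
    qed
    then have "finite {x \<in> {x \<in> carrier G. \<sigma> * F x = - 1}. s * F (inv g \<otimes> x) \<noteq> F x}"
      by (simp only: finite.emptyI)
    then have "s = \<epsilon> g" by (rule uniq[OF g s _ _ inf]) blast
    then have neg: "\<sigma> * D g x \<le> 0" if "x \<in> carrier G" for x
      using le[OF that] by (simp add: D_def right_diff_distrib)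
    have "\<sigma> * D g y \<noteq> 0" using y \<open>s = \<epsilon> g\<close> by (simp add: D_def right_diff_distrib)
    then have "\<sigma> * D g y < 0" using neg[OF y(1)] by linarith
    moreover have "y \<in> W g" using \<open>\<sigma> * D g y \<noteq> 0\<close> y(1) by (auto simp: W_def)
    ultimately have "y \<in> W g" "\<sigma> * D g y < 0" by simp_all
    then have "(\<Sum>x\<in>W g. \<sigma> * D g x) < (\<Sum>x\<in>W g. 0)"
      using neg finW[OF g] by (intro sum_strict_mono_ex1) (auto simp: W_def)
    then show ?thesis by (simp add: \<tau>_def sum_distrib_left)
  qed
  have "\<exists>g\<in>carrier G. \<tau> g < 0"
  proof -
    obtain g b y where g: "g \<in> carrier G" "\<And>x. x \<in> carrier G \<Longrightarrow> (inv g \<otimes> x \<in> E) = b \<Longrightarrow> x \<in> E"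
      and y: "y \<in> E" "(inv g \<otimes> y \<in> E) \<noteq> b"
      using ex_nested_translate[OF T E(1,2,4)] by blast
    have "{x \<in> carrier G. 1 * F x = - 1} = carrier G - E" by (auto simp: F_def)
    then have "1 * \<tau> g < 0"
      using g y E by (intro sign[of g 1 "if b then 1 else - 1" y]) (auto simp: F_def)
    then show ?thesis using g by auto
  qed
  moreover have "\<exists>g\<in>carrier G. 0 < \<tau> g"
  proof -
    let ?E = "carrier G - E"
    have "finite (vertex_boundary T ?E)"
      using E vertex_boundary_compl T by (simp add: cayley_generators_def)
    then obtain g b y where g: "g \<in> carrier G" "\<And>x. x \<in> carrier G \<Longrightarrow> (inv g \<otimes> x \<in> ?E) = b \<Longrightarrow> x \<in> ?E"
      and y: "y \<in> ?E" "(inv g \<otimes> y \<in> ?E) \<noteq> b"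
      using ex_nested_translate[OF T _ E(3)] by blast
    have "{x \<in> carrier G. - 1 * F x = - 1} = E" using E(1) by (auto simp: F_def)
    then have "- 1 * \<tau> g < 0"
      using g y E by (intro sign[of g "- 1" "if b then 1 else - 1" y]) (auto simp: F_def)
    then show ?thesis using g by auto
  qed
  ultimately show ?thesis using eps cocycle by (intro exI[of _ \<epsilon>] exI[of _ \<tau>] conjI ballI) simp_all
qed


subsection \<open>Walks along a height function\<close>

text \<open>The blocks are a rising step, and a nonfalling step followed by a rising one. Their
  weights \<open>r\<close> and \<open>r ^ 2\<close> with \<open>r = 1 / \<phi>\<close> add up to
  exactly 1.\<close>

lemma saw_count_ge_two_blocks:
  fixes h :: "'a \<Rightarrow> real"
  assumes T: "cayley_generators G T" and v: "v \<in> carrier G"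
    and T_step: "\<And>g. g \<in> carrier G \<Longrightarrow> u g \<in> T \<and> l g \<in> T \<and> u g \<noteq> l g"
    and up: "\<And>g. g \<in> carrier G \<Longrightarrow> h g < h (g \<otimes> u g)"
    and level: "\<And>g. g \<in> carrier G \<Longrightarrow> h g \<le> h (g \<otimes> l g)"
  shows "((1 + sqrt 5) / 2) ^ n / ((1 + sqrt 5) / 2) ^ 2 \<le> real (saw_count (cayley_graph G T) v n)"
proof -
  have TG: "t \<in> carrier G" "t \<noteq> \<one>" if "t \<in> T" for t
    using T that by (auto simp: cayley_generators_def)
  define Bl where "Bl g = {[g, g \<otimes> u g], [g, g \<otimes> l g, g \<otimes> l g \<otimes> u (g \<otimes> l g)]}" for g
  have ne: "g \<otimes> u g \<noteq> g \<otimes> l g" "g \<otimes> l g \<noteq> g" if "g \<in> carrier G" for g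
    using that T_step[OF that] TG by auto
  show ?thesis
  proof (rule exponential_saw_bound[where A = "carrier G" and h = h and Bl = Bl])
    show "finite {p. vpath p (cayley_graph G T) \<and> hd p = v \<and> vwalk_length p = n}" for v n
      by (rule finite_vpaths_cayley_graph[OF T])
    show "1 \<le> (1 + sqrt 5) / (2 :: real)" by simp
    fix g assume g: "g \<in> carrier G"
    let ?g = "g \<otimes> l g"
    have g': "g \<otimes> u g \<in> carrier G" "?g \<in> carrier G" "?g \<otimes> u ?g \<in> carrier G"
      using g T_step TG by auto
    have arcs: "(g, g \<otimes> u g) \<in> arcs_ends (cayley_graph G T)"
      "(g, ?g) \<in> arcs_ends (cayley_graph G T)" "(?g, ?g \<otimes> u ?g) \<in> arcs_ends (cayley_graph G T)"
      using g g' T_step by (auto simp: arcs_ends_cayley_graph)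
    have hs: "h g < h (g \<otimes> u g)" "h g \<le> h ?g" "h ?g < h (?g \<otimes> u ?g)"
      using up level g g' by auto
    show "vpath p (cayley_graph G T) \<and> hd p = g \<and> 2 \<le> length p \<and> length p \<le> Suc 2 \<and>
      last p \<in> carrier G \<and> (\<forall>x\<in>set p. h g \<le> h x) \<and> (\<forall>x\<in>set (butlast p). h x < h (last p))"
      if "p \<in> Bl g" for p
      using that g g' arcs hs ne[OF g] by (auto simp: Bl_def vpath_def vwalk_def)
    show "p = q" if "p \<in> Bl g" "q \<in> Bl g" "prefix p q" for p q
      using that ne[OF g] by (auto simp: Bl_def)
    show "finite (Bl g)" by (simp add: Bl_def)
    show "1 \<le> (\<Sum>p\<in>Bl g. (1 / ((1 + sqrt 5) / 2)) ^ (length p - 1) :: real)"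
      using ne[OF g] unfolding golden_ratio_inverse by (simp add: Bl_def power2_eq_square field_simps)
  qed (rule v)
qed

end

section \<open>Isometries of the line and the positions of the generators\<close>

text \<open>An action by isometries of the real line: \<open>g\<close> translates by
  \<open>\<tau> g\<close> if \<open>\<epsilon> g = 1\<close> and reflects in the centre
  \<open>\<tau> g / 2\<close> if \<open>\<epsilon> g = - 1\<close>.\<close>

locale affine_group_action = group G for G :: "('a, 'm) monoid_scheme" (structure) +
  fixes \<epsilon> \<tau> :: "'a \<Rightarrow> real"
  assumes eps: "g \<in> carrier G \<Longrightarrow> \<epsilon> g = 1 \<or> \<epsilon> g = - 1"
    and eps_mult: "g \<in> carrier G \<Longrightarrow> h \<in> carrier G \<Longrightarrow> \<epsilon> (g \<otimes> h) = \<epsilon> g * \<epsilon> h"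
    and tau_mult: "g \<in> carrier G \<Longrightarrow> h \<in> carrier G \<Longrightarrow> \<tau> (g \<otimes> h) = \<epsilon> g * \<tau> h + \<tau> g"
begin

lemma eps_one: "\<epsilon> \<one> = 1"
  using eps_mult[of \<one> \<one>] eps[of \<one>] by auto

lemma tau_one: "\<tau> \<one> = 0"
  using tau_mult[of \<one> \<one>] by (simp add: eps_one)

lemma eps_inv: "g \<in> carrier G \<Longrightarrow> \<epsilon> (inv g) = \<epsilon> g"
  using eps_mult[of g "inv g"] eps[of g] eps[of "inv g"] by (auto simp: eps_one)

lemma tau_inv: "g \<in> carrier G \<Longrightarrow> \<tau> (inv g) = - \<epsilon> g * \<tau> g"
  using tau_mult[of g "inv g"] eps[of g] by (auto simp: tau_one)

definition act :: "'a \<Rightarrow> real \<Rightarrow> real" where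
  "act g x = \<epsilon> g * x + \<tau> g"

lemma act_mult:
  "g \<in> carrier G \<Longrightarrow> t \<in> carrier G \<Longrightarrow> act (g \<otimes> t) x = act g x + \<epsilon> g * (act t x - x)"
  by (simp add: act_def eps_mult tau_mult algebra_simps)

text \<open>With height \<open>act g x\<close>, a step from \<open>g\<close> along \<open>t\<close>
  changes the height by \<open>\<epsilon> g\<close> times the displacement of \<open>x\<close> under
  \<open>t\<close>. Suitable generators for both signs therefore serve at every vertex.\<close>

lemma saw_count_ge_of_two_sided:
  assumes T: "cayley_generators G T" and v: "v \<in> carrier G"
    and moves: "\<And>s. s = 1 \<or> s = - 1 \<Longrightarrow>
      \<exists>u\<in>T. \<exists>l\<in>T. u \<noteq> l \<and> 0 < s * (act u x - x) \<and> 0 \<le> s * (act l x - x)"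
  shows "((1 + sqrt 5) / 2) ^ n / ((1 + sqrt 5) / 2) ^ 2 \<le> real (saw_count (cayley_graph G T) v n)"
proof -
  have TG: "t \<in> carrier G" if "t \<in> T" for t
    using T that by (auto simp: cayley_generators_def)
  have "\<exists>u l. u \<in> T \<and> l \<in> T \<and> u \<noteq> l \<and> 0 < \<epsilon> g * (act u x - x) \<and> 0 \<le> \<epsilon> g * (act l x - x)"
    if "g \<in> carrier G" for g
    using moves[OF eps[OF that]] by blast
  then obtain u l where ul: "\<And>g. g \<in> carrier G \<Longrightarrow> u g \<in> T \<and> l g \<in> T \<and> u g \<noteq> l g \<and>
      0 < \<epsilon> g * (act (u g) x - x) \<and> 0 \<le> \<epsilon> g * (act (l g) x - x)"
    by metis
  show ?thesis
  proof (rule saw_count_ge_two_blocks[OF T v, where h = "\<lambda>g. act g x" and u = u and l = l])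
    fix g assume g: "g \<in> carrier G"
    show "u g \<in> T \<and> l g \<in> T \<and> u g \<noteq> l g" using ul[OF g] by simp
    show "act g x < act (g \<otimes> u g) x" "act g x \<le> act (g \<otimes> l g) x"
      using ul[OF g] act_mult[OF g] TG by simp_all
  qed
qed

lemma saw_count_ge_of_translation:
  assumes T: "cayley_generators G T" and v: "v \<in> carrier G"
    and a: "a \<in> T" "\<epsilon> a = 1" "\<tau> a \<noteq> 0" and b: "b \<in> T" "b \<noteq> a" "b \<noteq> inv a"
  shows "((1 + sqrt 5) / 2) ^ n / ((1 + sqrt 5) / 2) ^ 2 \<le> real (saw_count (cayley_graph G T) v n)"
proof (rule saw_count_ge_of_two_sided[OF T v])
  have TG: "t \<in> carrier G" "inv t \<in> T" if "t \<in> T" for t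
    using T that by (auto simp: cayley_generators_def)
  \<comment> \<open>If \<open>b\<close> is a reflection, its centre as base point makes
    \<open>b\<close> a level step; if it is a translation, \<open>b\<close> or \<open>inv b\<close>
    does not fall, whatever the base point.\<close>
  define x where "x = (if \<epsilon> b = 1 then 0 else \<tau> b / 2)"
  fix s :: real assume s: "s = 1 \<or> s = - 1"
  define u where "u = (if 0 < s * \<tau> a then a else inv a)"
  define l where "l = (if \<epsilon> b = 1 \<and> s * \<tau> b < 0 then inv b else b)"
  have u: "u \<in> T" "0 < s * (act u x - x)"
    using s a TG[OF a(1)] by (auto simp: u_def act_def eps_inv tau_inv)
  have l: "l \<in> T" "0 \<le> s * (act l x - x)"
    using s b TG[OF b(1)] eps[of b] by (auto simp: l_def act_def eps_inv tau_inv x_def)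
  have "inv b \<noteq> a" "inv b \<noteq> inv a"
    using b TG[OF b(1)] TG[OF a(1)] by (metis inv_inv)+
  then have "u \<noteq> l" using b by (auto simp: u_def l_def)
  then show "\<exists>u\<in>T. \<exists>l\<in>T. u \<noteq> l \<and> 0 < s * (act u x - x) \<and> 0 \<le> s * (act l x - x)"
    using u l by blast
qed

lemma saw_count_ge_of_fixed_point:
  assumes T: "cayley_generators G T" and v: "v \<in> carrier G"
    and T_mem: "a \<in> T" "b \<in> T" "c \<in> T" and "act a x < x" "x < act b x" "act c x = x"
  shows "((1 + sqrt 5) / 2) ^ n / ((1 + sqrt 5) / 2) ^ 2 \<le> real (saw_count (cayley_graph G T) v n)"
proof (rule saw_count_ge_of_two_sided[OF T v])
  fix s :: real assume "s = 1 \<or> s = - 1"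
  then show "\<exists>u\<in>T. \<exists>l\<in>T. u \<noteq> l \<and> 0 < s * (act u x - x) \<and> 0 \<le> s * (act l x - x)"
  proof
    assume "s = 1"
    then show ?thesis using assms by (intro bexI[of _ b] bexI[of _ c]) auto
  next
    assume "s = - 1"
    then show ?thesis using assms by (intro bexI[of _ a] bexI[of _ c]) auto
  qed
qed

text \<open>Seen from the midpoint of the two centres, these reflections change the height by
  exactly \<open>d\<close>. At vertices with the sign of \<open>v\<close>, \<open>a\<close> and
  \<open>a'\<close> rise and \<open>b\<close> falls; at the others the directions are reversed. Each
  block thus alternates signs and ends at a vertex of \<open>A\<close> at height
  \<open>2 * d\<close> above its start.\<close>

lemma saw_count_ge_of_two_centres:
  assumes T: "cayley_generators G T" and v: "v \<in> carrier G"
    and a: "a \<in> T" "\<epsilon> a = - 1" and a': "a' \<in> T" "\<epsilon> a' = - 1" and b: "b \<in> T" "\<epsilon> b = - 1"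
    and ne: "a \<noteq> a'" and tau: "\<tau> a' = \<tau> a" "\<tau> b \<noteq> \<tau> a"
  shows "((1 + sqrt 5) / 2) ^ n / ((1 + sqrt 5) / 2) ^ 4 \<le> real (saw_count (cayley_graph G T) v n)"
proof -
  have TG: "t \<in> carrier G" "inv t \<in> T" if "t \<in> T" for t
    using T that by (auto simp: cayley_generators_def)
  \<comment> \<open>The centres are \<open>\<tau> a / 2\<close> and \<open>\<tau> b / 2\<close>;
    this is their midpoint. The sign \<open>\<sigma>\<close> orients the height so that
    \<open>a\<close> rises at \<open>v\<close>.\<close>
  define x where "x = (\<tau> a + \<tau> b) / 4"
  define \<sigma> where "\<sigma> = \<epsilon> v * sgn (\<tau> a - \<tau> b)"
  define d where "d = \<bar>\<tau> a - \<tau> b\<bar> / 2"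
  define h where "h g = \<sigma> * act g x" for g
  define A where "A = {g \<in> carrier G. \<epsilon> g = \<epsilon> v}"
  have d: "0 < d" using tau by (simp add: d_def)
  have sd: "sgn (\<tau> a - \<tau> b) * ((\<tau> a - \<tau> b) / 2) = d"
    by (simp add: d_def sgn_if)
  have sides: "\<tau> a - 2 * x = (\<tau> a - \<tau> b) / 2" "\<tau> b - 2 * x = - ((\<tau> a - \<tau> b) / 2)"
    by (simp_all add: x_def field_simps)
  have h_mult: "h (g \<otimes> t) = h g + \<sigma> * \<epsilon> g * (\<tau> t - 2 * x)"
    if "g \<in> carrier G" "t \<in> carrier G" "\<epsilon> t = - 1" for g t
  proof -
    have "act (g \<otimes> t) x = act g x + \<epsilon> g * (\<tau> t - 2 * x)"
      using act_mult[OF that(1,2), of x] that(3) by (simp add: act_def[of t] algebra_simps)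
    then show ?thesis unfolding h_def by (simp only:) (simp add: algebra_simps)
  qed
  have "\<sigma> * \<epsilon> v = sgn (\<tau> a - \<tau> b)"
    using eps[OF v] by (auto simp: \<sigma>_def)
  then have dir: "\<sigma> * \<epsilon> v * (\<tau> a - 2 * x) = d" "\<sigma> * \<epsilon> v * (\<tau> b - 2 * x) = - d"
    unfolding sides by (simp_all only: mult_minus_right sd)
  have up: "h (g \<otimes> t) = h g + d" if "g \<in> A" "t \<in> carrier G" "\<epsilon> t = - 1" "\<tau> t = \<tau> a" for g t
    using h_mult[of g t] that dir by (simp add: A_def)
  have down: "h (g \<otimes> t) = h g - d"
    if "g \<in> carrier G" "\<epsilon> g = - \<epsilon> v" "t \<in> carrier G" "\<epsilon> t = - 1" "\<tau> t = \<tau> a" for g t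
    using h_mult[of g t] that dir by simp
  have across: "h (g \<otimes> b) = h g + d" if "g \<in> carrier G" "\<epsilon> g = - \<epsilon> v" for g
    using h_mult[of g b] that dir b TG by simp
  define short where "short g s = [g, g \<otimes> s, g \<otimes> s \<otimes> b]" for g s
  \<comment> \<open>A zigzag up, down, up, up. The inverse of \<open>s'\<close> reflects in the same
    centre as \<open>s\<close> and so falls; \<open>s \<noteq> s'\<close> prevents the return to
    \<open>g\<close>.\<close>
  define long where "long g s s' = [g, g \<otimes> s, g \<otimes> s \<otimes> inv s', g \<otimes> s \<otimes> inv s' \<otimes> s,
    g \<otimes> s \<otimes> inv s' \<otimes> s \<otimes> b]" for g s s'
  define Bl where "Bl g = {short g a, short g a', long g a a', long g a' a}" for g
  define ok where "ok g p \<longleftrightarrow> vpath p (cayley_graph G T) \<and> hd p = g \<and> 2 \<le> length p \<and>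
    length p \<le> Suc 4 \<and> last p \<in> A \<and> (\<forall>x\<in>set p. h g \<le> h x) \<and>
    (\<forall>x\<in>set (butlast p). h x < h (last p))" for g p
  have blocks: "ok g (short g s)" "ok g (long g s s')" "g \<otimes> s \<otimes> b \<noteq> g \<otimes> s \<otimes> inv s'"
    if g: "g \<in> A" and s: "s \<in> T" "\<epsilon> s = - 1" "\<tau> s = \<tau> a"
      and s': "s' \<in> T" "\<epsilon> s' = - 1" "\<tau> s' = \<tau> a" and ss': "s \<noteq> s'" for g s s'
  proof -
    define p q r y z where "p = g \<otimes> s" and "q = p \<otimes> b" and "r = p \<otimes> inv s'" and "y = r \<otimes> s"
      and "z = y \<otimes> b"
    note defs = p_def q_def r_def y_def z_def
    have G: "g \<in> carrier G" "s \<in> carrier G" "s' \<in> carrier G" "b \<in> carrier G"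
      using g s s' b TG by (auto simp: A_def)
    have c: "p \<in> carrier G" "q \<in> carrier G" "r \<in> carrier G" "y \<in> carrier G" "z \<in> carrier G"
      using G by (simp_all add: defs)
    have e: "\<epsilon> p = - \<epsilon> v" "\<epsilon> q = \<epsilon> v" "\<epsilon> r = \<epsilon> v" "\<epsilon> y = - \<epsilon> v" "\<epsilon> z = \<epsilon> v"
      using G g s s' b by (simp_all add: defs eps_mult eps_inv A_def)
    have hh: "h p = h g + d" "h q = h g + 2 * d" "h r = h g" "h y = h g + d" "h z = h g + 2 * d"
    proof -
      show p: "h p = h g + d" unfolding p_def using up g G s by blast
      show "h q = h g + 2 * d" unfolding q_def using across[OF c(1) e(1)] p by simp
      show r: "h r = h g" unfolding r_def
        using down[OF c(1) e(1), of "inv s'"] p G s' by (simp add: eps_inv tau_inv)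
      show y: "h y = h g + d" unfolding y_def using up[of r s] c e G s r by (simp add: A_def)
      show "h z = h g + 2 * d" unfolding z_def using across[OF c(4) e(4)] y by simp
    qed
    have arcs: "(g, p) \<in> arcs_ends (cayley_graph G T)" "(p, q) \<in> arcs_ends (cayley_graph G T)"
      "(p, r) \<in> arcs_ends (cayley_graph G T)" "(r, y) \<in> arcs_ends (cayley_graph G T)"
      "(y, z) \<in> arcs_ends (cayley_graph G T)"
      using G c s s' b TG by (auto simp: arcs_ends_cayley_graph defs)
    \<comment> \<open>The heights separate all vertices of the zigzag except the pairs
      \<open>g\<close>, \<open>r\<close> and \<open>p\<close>, \<open>y\<close>.\<close>
    have "r \<noteq> g"
    proof
      assume "r = g"
      then have "g \<otimes> (s \<otimes> inv s') = g" using G by (simp add: defs m_assoc)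
      then have "s \<otimes> inv s' = \<one>" using G by simp
      then show False using ss' G by (metis inv_closed inv_equality inv_inv)
    qed
    moreover have "y \<noteq> p" using \<open>r \<noteq> g\<close> G c by (simp add: y_def p_def)
    ultimately have "distinct [g, p, r, y, z]" "distinct [g, p, q]" using hh d by auto
    moreover have "short g s = [g, p, q]" "long g s s' = [g, p, r, y, z]"
      by (simp_all add: short_def long_def defs)
    ultimately show "ok g (short g s)" "ok g (long g s s')"
      using arcs c e hh d G by (auto simp: ok_def vpath_def vwalk_def A_def)
    have "q \<noteq> r" using hh d by auto
    then show "g \<otimes> s \<otimes> b \<noteq> g \<otimes> s \<otimes> inv s'" by (simp add: defs)
  qed
  have okB: "ok g p" if "g \<in> A" "p \<in> Bl g" for g p
    using that(2) blocks[OF that(1), of a a'] blocks[OF that(1), of a' a] a a' ne tau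
    by (auto simp: Bl_def)
  have diff: "g \<otimes> a \<noteq> g \<otimes> a'" "g \<otimes> a \<otimes> b \<noteq> g \<otimes> a \<otimes> inv a'" "g \<otimes> a' \<otimes> b \<noteq> g \<otimes> a' \<otimes> inv a"
    if "g \<in> A" for g
    using blocks(3)[OF that, of a a'] blocks(3)[OF that, of a' a] a a' ne tau TG that
    by (auto simp: A_def)
  show ?thesis
  proof (rule exponential_saw_bound[where A = A and h = h and Bl = Bl])
    show "finite {p. vpath p (cayley_graph G T) \<and> hd p = v \<and> vwalk_length p = n}" for v n
      by (rule finite_vpaths_cayley_graph[OF T])
    show "1 \<le> (1 + sqrt 5) / (2 :: real)" by simp
    show "v \<in> A" using v by (simp add: A_def)
    fix g assume g: "g \<in> A"
    show "vpath p (cayley_graph G T) \<and> hd p = g \<and> 2 \<le> length p \<and> length p \<le> Suc 4 \<and>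
      last p \<in> A \<and> (\<forall>x\<in>set p. h g \<le> h x) \<and> (\<forall>x\<in>set (butlast p). h x < h (last p))"
      if "p \<in> Bl g" for p
      using okB[OF g that] by (simp add: ok_def)
    show "p = q" if "p \<in> Bl g" "q \<in> Bl g" "prefix p q" for p q
      using that diff[OF g] unfolding Bl_def short_def long_def by auto
    show "finite (Bl g)" by (simp add: Bl_def)
    \<comment> \<open>By \<open>r ^ 2 = 1 - r\<close> the total weight
      \<open>2 * r ^ 2 + 2 * r ^ 4\<close> equals \<open>6 - 8 * r\<close>, which is at least 1
      exactly when \<open>r \<le> 5 / 8\<close>, that is, \<open>sqrt 5 \<le> 9 / 4\<close>.\<close>
    have "sqrt 5 \<le> (9 / 4 :: real)" by (rule real_le_lsqrt) (auto simp: power2_eq_square)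
    define r :: real where "r = (sqrt 5 - 1) / 2"
    have "r \<le> 5 / 8" using \<open>sqrt 5 \<le> 9 / 4\<close> by (simp add: r_def)
    have r2: "r ^ 2 = 1 - r" by (simp add: r_def power2_eq_square field_simps)
    have "r ^ 4 = (r ^ 2) ^ 2" by simp
    also have "\<dots> = 2 - 3 * r" unfolding r2 using r2 by (simp add: power2_eq_square algebra_simps)
    finally have r4: "r ^ 4 = 2 - 3 * r" .
    have "(\<Sum>p\<in>Bl g. r ^ (length p - 1)) = 2 * r ^ 2 + 2 * r ^ 4"
      using diff[OF g] diff(1)[OF g, symmetric]
      by (simp add: Bl_def short_def long_def power2_eq_square power4_eq_xxxx mult.assoc)
    also have "\<dots> \<ge> 1" using \<open>r \<le> 5 / 8\<close> unfolding r2 r4 by simp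
    finally show "1 \<le> (\<Sum>p\<in>Bl g. (1 / ((1 + sqrt 5) / 2)) ^ (length p - 1) :: real)"
      unfolding golden_ratio_inverse r_def .
  qed
qed

lemma connective_constant_ge_golden_ratio:
  assumes T: "cayley_generators G T" "3 \<le> card T" and v: "v \<in> carrier G"
    and neg: "\<exists>g\<in>carrier G. \<tau> g < 0" and pos: "\<exists>g\<in>carrier G. 0 < \<tau> g"
  shows "(1 + sqrt 5) / 2 \<le> connective_constant (cayley_graph G T) v"
proof -
  let ?\<phi> = "(1 + sqrt 5) / 2 :: real"
  have \<phi>: "0 < ?\<phi>" by (simp add: add_pos_pos)
  have TG: "t \<in> carrier G" if "t \<in> T" for t
    using T that by (auto simp: cayley_generators_def)
  have third: "\<exists>c\<in>T. c \<noteq> a \<and> c \<noteq> b" for a b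
  proof (rule ccontr)
    assume "\<not> ?thesis"
    then have "T \<subseteq> {a, b}" by blast
    then have "card T \<le> card {a, b}" by (intro card_mono) auto
    then show False using T(2) card_insert_le_m1[of 2 "{b}" a] by (simp split: if_splits add: card_insert_if)
  qed
  have "\<exists>L::nat. \<forall>n. ?\<phi> ^ n / ?\<phi> ^ L \<le> real (saw_count (cayley_graph G T) v n)"
  proof (cases "\<exists>a\<in>T. \<epsilon> a = 1 \<and> \<tau> a \<noteq> 0")
    case True
    then obtain a where a: "a \<in> T" "\<epsilon> a = 1" "\<tau> a \<noteq> 0" by blast
    obtain b where "b \<in> T" "b \<noteq> a" "b \<noteq> inv a" using third by blast
    then show ?thesis using saw_count_ge_of_translation[OF T(1) v a] by blast
  next
    case False
    then have tau0: "\<tau> t = 0" if "t \<in> T" "\<epsilon> t = 1" for t using that by blast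
    \<comment> \<open>Every generator now acts trivially or as a reflection. If all centres
      coincided, the generators, and with them the whole group, would fix a point.\<close>
    have "\<exists>a\<in>T. \<exists>b\<in>T. \<epsilon> a = - 1 \<and> \<epsilon> b = - 1 \<and> \<tau> a < \<tau> b"
    proof (rule ccontr)
      assume "\<not> ?thesis"
      then have eq: "\<tau> a = \<tau> b" if "a \<in> T" "b \<in> T" "\<epsilon> a = - 1" "\<epsilon> b = - 1" for a b
        using that by (meson linorder_neqE)
      have "\<exists>x. \<forall>t\<in>T. act t x = x"
      proof (cases "\<exists>c\<in>T. \<epsilon> c = - 1")
        case True
        then obtain c where c: "c \<in> T" "\<epsilon> c = - 1" by blast
        have "act t (\<tau> c / 2) = \<tau> c / 2" if "t \<in> T" for t
          using eps[OF TG[OF that]] tau0[OF that] eq[OF that c(1) _ c(2)] by (auto simp: act_def)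
        then show ?thesis by blast
      next
        case False
        then have "act t 0 = 0" if "t \<in> T" for t
          using eps[OF TG[OF that]] tau0[OF that] that by (auto simp: act_def)
        then show ?thesis by blast
      qed
      then obtain x where x: "\<And>t. t \<in> T \<Longrightarrow> act t x = x" by blast
      have fixed: "act g x = x" if "g \<in> carrier G" for g
        using T(1) that
        by (induction rule: cayley_induct) (simp_all add: act_def eps_one tau_one, simp flip: act_def add: act_mult TG x)
      \<comment> \<open>A fixed point \<open>x\<close> and \<open>\<tau> g \<noteq> 0\<close> force
        \<open>\<epsilon> g = - 1\<close> and \<open>\<tau> g = 2 * x\<close>, which cannot hold for
        values of both signs.\<close>
      obtain g g' where "g \<in> carrier G" "\<tau> g < 0" "g' \<in> carrier G" "0 < \<tau> g'"
        using neg pos by blast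
      then show False using fixed[of g] fixed[of g'] eps[of g] eps[of g'] by (auto simp: act_def)
    qed
    then obtain a b where a: "a \<in> T" "\<epsilon> a = - 1" and b: "b \<in> T" "\<epsilon> b = - 1" and ab: "\<tau> a < \<tau> b"
      by blast
    obtain c where c: "c \<in> T" "c \<noteq> a" "c \<noteq> b" using third by blast
    \<comment> \<open>If \<open>c\<close> acts trivially, the midpoint of the two centres is a level
      base point between them; if the three centres differ, the middle one is. A repeated centre
      leads to the blocks of lengths 2 and 4.\<close>
    consider "\<epsilon> c = 1" | "\<epsilon> c = - 1" "\<tau> c < \<tau> a" | "\<epsilon> c = - 1" "\<tau> c = \<tau> a"
      | "\<epsilon> c = - 1" "\<tau> a < \<tau> c" "\<tau> c < \<tau> b" | "\<epsilon> c = - 1" "\<tau> c = \<tau> b" | "\<epsilon> c = - 1" "\<tau> b < \<tau> c"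
      using eps[OF TG[OF c(1)]] by linarith
    then show ?thesis
    proof cases
      case 1
      define m where "m = (\<tau> a + \<tau> b) / 4"
      then have "4 * m = \<tau> a + \<tau> b" by simp
      then have "act a m < m" "m < act b m" "act c m = m"
        using 1 a b ab tau0[OF c(1)] by (simp_all add: act_def)
      then show ?thesis using saw_count_ge_of_fixed_point[OF T(1) v a(1) b(1) c(1)] by blast
    next
      case 2
      have "act c (\<tau> a / 2) < \<tau> a / 2" "\<tau> a / 2 < act b (\<tau> a / 2)" "act a (\<tau> a / 2) = \<tau> a / 2"
        using 2 a b ab by (simp_all add: act_def)
      then show ?thesis using saw_count_ge_of_fixed_point[OF T(1) v c(1) b(1) a(1)] by blast
    next
      case 3
      then show ?thesis
        using saw_count_ge_of_two_centres[OF T(1) v a c(1) _ b c(2)[symmetric]] ab by auto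
    next
      case 4
      have "act a (\<tau> c / 2) < \<tau> c / 2" "\<tau> c / 2 < act b (\<tau> c / 2)" "act c (\<tau> c / 2) = \<tau> c / 2"
        using 4 a b ab by (simp_all add: act_def)
      then show ?thesis using saw_count_ge_of_fixed_point[OF T(1) v a(1) b(1) c(1)] by blast
    next
      case 5
      then show ?thesis
        using saw_count_ge_of_two_centres[OF T(1) v b c(1) _ a c(3)[symmetric]] ab by auto
    next
      case 6
      have "act a (\<tau> b / 2) < \<tau> b / 2" "\<tau> b / 2 < act c (\<tau> b / 2)" "act b (\<tau> b / 2) = \<tau> b / 2"
        using 6 a b ab by (simp_all add: act_def)
      then show ?thesis using saw_count_ge_of_fixed_point[OF T(1) v a(1) c(1) b(1)] by blast
    qed
  qed
  then obtain L :: nat where "\<And>n. ?\<phi> ^ n / ?\<phi> ^ L \<le> real (saw_count (cayley_graph G T) v n)" by blast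
  then have "?\<phi> ^ n * (1 / ?\<phi> ^ L) \<le> real (saw_count (cayley_graph G T) v n)" for n by simp
  then show ?thesis
    using \<phi> by (intro connective_constant_ge[OF T(1) v, of "1 / ?\<phi> ^ L"]) auto
qed

end

theorem theorem10p1:
  fixes \<Gamma> :: "('g, 'm) monoid_scheme" and S :: "'x set" and R :: "'x gword set"
    and T :: "'g set" and v :: 'g
  assumes "group \<Gamma>"
    and "finite S" and "finite R" and "R \<subseteq> gwords S"
    and "\<Gamma> \<cong> presented_group S R"
    and "group_ends \<Gamma> = 2"
    and "cayley_generators \<Gamma> T"
    and "v \<in> carrier \<Gamma>"
    and "3 \<le> out_degree (cayley_graph \<Gamma> T) v"
  shows "(1 + sqrt 5) / 2 \<le> connective_constant (cayley_graph \<Gamma> T) v"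
proof -
  interpret group \<Gamma> by (rule assms(1))
  \<comment> \<open>\<open>group_ends\<close> counts ends for a chosen generating set that may
    differ from \<open>T\<close>. The action obtained from it concerns the group alone and can be
    evaluated on the generators in \<open>T\<close>.\<close>
  have "cayley_generators \<Gamma> (SOME T. cayley_generators \<Gamma> T)"
    using assms(7) by (rule someI)
  note action = ex_affine_action[OF this assms(6)[unfolded group_ends_def]]
  obtain \<epsilon> \<tau> :: "'g \<Rightarrow> real" where eps: "\<forall>g\<in>carrier \<Gamma>. \<epsilon> g = 1 \<or> \<epsilon> g = - 1"
    and mult: "\<forall>g\<in>carrier \<Gamma>. \<forall>h\<in>carrier \<Gamma>. \<epsilon> (g \<otimes>\<^bsub>\<Gamma>\<^esub> h) = \<epsilon> g * \<epsilon> h \<and>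
      \<tau> (g \<otimes>\<^bsub>\<Gamma>\<^esub> h) = \<epsilon> g * \<tau> h + \<tau> g"
    and signs: "\<exists>g\<in>carrier \<Gamma>. \<tau> g < 0" "\<exists>g\<in>carrier \<Gamma>. 0 < \<tau> g"
    using action by (elim exE conjE) (rule that)
  interpret affine_group_action \<Gamma> \<epsilon> \<tau>
    by unfold_locales (use eps mult in blast)+
  have "3 \<le> card T" using assms(9) out_degree_cayley_graph[OF assms(7,8)] by simp
  then show ?thesis using connective_constant_ge_golden_ratio assms(7,8) signs by blast
qed

end
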